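(* Let $$0<\tau\le\min\left\{\frac{1}{4\|p\|_{1,\infty}},\ \frac{h^2}{16\,c_{0,inv}\|W(t)\|_M}\right\}=O(h^2).$$ Then for every $U\in\mathbb{R}^N$ and $\gamma\in\mathbb{R}^N$ the linear system $$\begin{bmatrix}-\tau R&M+\tau S(U)\\ K&-M\end{bmatrix}\begin{bmatrix}\alpha\\ \beta\end{bmatrix}=\begin{bmatrix}M\gamma\\ 0\end{bmatrix}$$ has a unique solution $(\alpha,\beta)\in\mathbb{R}^N\times\mathbb{R}^N$.
   Context: $\Omega=(0,L)^2$; $\langle\cdot,\cdot\rangle_2$, $\|\cdot\|_2$ are the $L^2(\Omega)$ inner product and norm; $\langle u,v\rangle_{H^1}=\langle u,v\rangle_2+\langle\nabla u,\nabla v\rangle_2$, with norm $\|\cdot\|_{H^1}$. For a function $u$, $\vec V(u)=(-u_y,u_x)$. $p\in W^{1,\infty}(\Omega)$ is given, $\|p\|_{1,\infty}=\max\{\|p\|_{L^\infty},\|p_x\|_{L^\infty},\|p_y\|_{L^\infty}\}$ (with $1/0=+\infty$). Finite elements: $\overline\Omega$ is covered by an $n\times n$ tensor grid of nodes and a conforming structured triangulation based on it, with mesh size $h$. $X_N$ is the space of continuous functions on $\overline\Omega$ that are affine on each triangle; $X_{N,P}\subset X_N$ is the subspace of functions satisfying periodic boundary conditions (equal values at corresponding points of opposite sides of $\Omega$), of dimension $N=(n-1)^2$, with nodal basis $\varphi_1,\dots,\varphi_N$. $c_{0,inv}>0$ is a constant such that $\|v\|_{H^1}\le\frac{c_{0,inv}}{h}\|v\|_2$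 for all $v\in X_N$. $N\times N$ matrices: $M_{I,J}=\langle\varphi_I,\varphi_J\rangle_2$, $K_{I,J}=\langle\varphi_I,\varphi_J\rangle_{H^1}$, $R_{I,J}=\langle\vec V(p)\cdot\nabla\varphi_J,\varphi_I\rangle_2$; for $U\in\mathbb{R}^N$, $S_{I,J}(U)=-\langle\vec V(\sum_LU_L\varphi_L)\cdot\nabla\varphi_I,\varphi_J\rangle_2$. $\|a\|_M^2=a^TMa$ for $a\in\mathbb{R}^N$. $W(t)\in\mathbb{R}^N$ is a given vector (the coefficient vector of the already computed approximation $w_N(t)\in X_{N,P}$ at the current time $t$). *)

theory Defs
  imports "HOL-Analysis.Analysis" "HOL-Probability.Essential_Supremum"
begin

section \<open>Functions on the square\<close>

definition Omega :: "real \<Rightarrow> (real \<times> real) set" where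
  "Omega L = {0<..<L} \<times> {0<..<L}"

definition Omega_bar :: "real \<Rightarrow> (real \<times> real) set" where
  "Omega_bar L = {0..L} \<times> {0..L}"

text \<open>Classical pointwise partial derivatives.  For a continuous function that is affine on
  every triangle of a mesh they exist inside the triangles and give the usual elementwise (and
  weak) gradient.  The values of \<open>deriv\<close> on the edges are irrelevant: the edges form
  a null set, and all integrals below are taken with respect to the completed Lebesgue measure.\<close>

definition grad :: "(real \<times> real \<Rightarrow> real) \<Rightarrow> real \<times> real \<Rightarrow> real \<times> real" where
  "grad u z = (deriv (\<lambda>x. u (x, snd z)) (fst z), deriv (\<lambda>y. u (fst z, y)) (snd z))"

text \<open>The field \<open>(- u_y, u_x)\<close>, expressed through the gradient field \<open>g = (u_x, u_y)\<close>.\<close>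

definition Vrot :: "(real \<times> real \<Rightarrow> real \<times> real) \<Rightarrow> real \<times> real \<Rightarrow> real \<times> real" where
  "Vrot g z = (- snd (g z), fst (g z))"

definition L2_inner :: "real \<Rightarrow> (real \<times> real \<Rightarrow> real) \<Rightarrow> (real \<times> real \<Rightarrow> real) \<Rightarrow> real" where
  "L2_inner L u v = (LINT z|lebesgue_on (Omega L). u z * v z)"

definition H1_inner :: "real \<Rightarrow> (real \<times> real \<Rightarrow> real) \<Rightarrow> (real \<times> real \<Rightarrow> real) \<Rightarrow> real" where
  "H1_inner L u v = L2_inner L u v + (LINT z|lebesgue_on (Omega L). grad u z \<bullet> grad v z)"

definition L2_nrm :: "real \<Rightarrow> (real \<times> real \<Rightarrow> real) \<Rightarrow> real" where
  "L2_nrm L u = sqrt (L2_inner L u u)"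

definition H1_nrm :: "real \<Rightarrow> (real \<times> real \<Rightarrow> real) \<Rightarrow> real" where
  "H1_nrm L u = sqrt (H1_inner L u u)"

section \<open>The Sobolev space \<open>W\<^sup>1\<^sup>,\<^sup>\<infinity>\<close>\<close>

primrec C_k :: "nat \<Rightarrow> (real \<times> real \<Rightarrow> real) \<Rightarrow> bool" where
  "C_k 0 f \<longleftrightarrow> continuous_on UNIV f"
| "C_k (Suc k) f \<longleftrightarrow> (\<forall>z. f differentiable (at z)) \<and>
     C_k k (\<lambda>z. fst (grad f z)) \<and> C_k k (\<lambda>z. snd (grad f z))"

definition test_function :: "real \<Rightarrow> (real \<times> real \<Rightarrow> real) \<Rightarrow> bool" where
  "test_function L f \<longleftrightarrow> (\<forall>k. C_k k f) \<and>
     (\<exists>C. compact C \<and> C \<subseteq> Omega L \<and> (\<forall>z. z \<notin> C \<longrightarrow> f z = 0))"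

definition Linf_nrm :: "real \<Rightarrow> (real \<times> real \<Rightarrow> real) \<Rightarrow> ereal" where
  "Linf_nrm L f = esssup (lebesgue_on (Omega L)) (\<lambda>z. ereal \<bar>f z\<bar>)"

definition Linf :: "real \<Rightarrow> (real \<times> real \<Rightarrow> real) set" where
  "Linf L = {f. f \<in> borel_measurable (lebesgue_on (Omega L)) \<and> Linf_nrm L f < \<infinity>}"

text \<open>\<open>W1inf L p g\<close>: the function \<open>p\<close> belongs to the Sobolev space on \<open>Omega L\<close>, and
  \<open>g\<close> (determined up to null sets) is its weak gradient.\<close>

definition W1inf :: "real \<Rightarrow> (real \<times> real \<Rightarrow> real) \<Rightarrow> (real \<times> real \<Rightarrow> real \<times> real) \<Rightarrow> bool" where
  "W1inf L p g \<longleftrightarrow>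
     p \<in> Linf L \<and> (\<lambda>z. fst (g z)) \<in> Linf L \<and> (\<lambda>z. snd (g z)) \<in> Linf L \<and>
     (\<forall>f. test_function L f \<longrightarrow>
        L2_inner L p (\<lambda>z. fst (grad f z)) = - L2_inner L (\<lambda>z. fst (g z)) f \<and>
        L2_inner L p (\<lambda>z. snd (grad f z)) = - L2_inner L (\<lambda>z. snd (g z)) f)"

definition W1inf_nrm :: "real \<Rightarrow> (real \<times> real \<Rightarrow> real) \<Rightarrow> (real \<times> real \<Rightarrow> real \<times> real) \<Rightarrow> ereal" where
  "W1inf_nrm L p g =
     max (Linf_nrm L p) (max (Linf_nrm L (\<lambda>z. fst (g z))) (Linf_nrm L (\<lambda>z. snd (g z))))"

section \<open>Finite elements\<close>

text \<open>The \<open>n\<close> nodes in each coordinate direction are \<open>xs 0, \<dots>, xs (n - 1)\<close> and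
  \<open>ys 0, \<dots>, ys (n - 1)\<close>; the grid need not be equidistant.\<close>

definition tensor_grid :: "real \<Rightarrow> nat \<Rightarrow> (nat \<Rightarrow> real) \<Rightarrow> (nat \<Rightarrow> real) \<Rightarrow> bool" where
  "tensor_grid L n xs ys \<longleftrightarrow>
     strict_mono_on {..<n} xs \<and> xs 0 = 0 \<and> xs (n - 1) = L \<and>
     strict_mono_on {..<n} ys \<and> ys 0 = 0 \<and> ys (n - 1) = L"

text \<open>Every grid cell is cut into two triangles along one of its diagonals, \<open>dg i j\<close> telling
  which one.  No vertices are added, so the triangulation is conforming for every \<open>dg\<close>;
  a constant \<open>dg\<close> gives parallel diagonals.\<close>

definition cell_triangles ::
    "(nat \<Rightarrow> real) \<Rightarrow> (nat \<Rightarrow> real) \<Rightarrow> (nat \<Rightarrow> nat \<Rightarrow> bool) \<Rightarrow> nat \<Rightarrow> nat \<Rightarrow> (real \<times> real) set set" where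
  "cell_triangles xs ys dg i j =
     (let sw = (xs i, ys j); se = (xs (Suc i), ys j);
          nw = (xs i, ys (Suc j)); ne = (xs (Suc i), ys (Suc j))
      in if dg i j then {convex hull {sw, se, ne}, convex hull {sw, nw, ne}}
         else {convex hull {sw, se, nw}, convex hull {se, nw, ne}})"

definition mesh_triangles ::
    "nat \<Rightarrow> (nat \<Rightarrow> real) \<Rightarrow> (nat \<Rightarrow> real) \<Rightarrow> (nat \<Rightarrow> nat \<Rightarrow> bool) \<Rightarrow> (real \<times> real) set set" where
  "mesh_triangles n xs ys dg = (\<Union>i<n - 1. \<Union>j<n - 1. cell_triangles xs ys dg i j)"

definition mesh_size :: "(real \<times> real) set set \<Rightarrow> real" where
  "mesh_size T = Max (diameter ` T)"

text \<open>Membership only concerns the values on \<open>Omega_bar L\<close>.\<close>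

definition X_N :: "real \<Rightarrow> (real \<times> real) set set \<Rightarrow> (real \<times> real \<Rightarrow> real) set" where
  "X_N L T = {v. continuous_on (Omega_bar L) v \<and> (\<forall>K\<in>T. \<exists>a c. \<forall>z\<in>K. v z = a \<bullet> z + c)}"

definition X_NP :: "real \<Rightarrow> (real \<times> real) set set \<Rightarrow> (real \<times> real \<Rightarrow> real) set" where
  "X_NP L T = {v \<in> X_N L T. (\<forall>s\<in>{0..L}. v (0, s) = v (L, s) \<and> v (s, 0) = v (s, L))}"

text \<open>Periodicity identifies the last grid line with the first one in each direction, so the
  nodes with both indices below \<open>n - 1\<close> represent all nodes.  They are numbered by the
  index type \<open>'N\<close>, which therefore has \<open>(n - 1)\<^sup>2\<close> elements.\<close>

definition nodal_basis ::
    "real \<Rightarrow> nat \<Rightarrow> (nat \<Rightarrow> real) \<Rightarrow> (nat \<Rightarrow> real) \<Rightarrow> (nat \<Rightarrow> nat \<Rightarrow> bool) \<Rightarrow>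
     ('N::finite \<Rightarrow> real \<times> real \<Rightarrow> real) \<Rightarrow> bool" where
  "nodal_basis L n xs ys dg \<phi> \<longleftrightarrow>
     (\<exists>node. bij_betw node (UNIV :: 'N set) (xs ` {..<n - 1} \<times> ys ` {..<n - 1}) \<and>
        (\<forall>I. \<phi> I \<in> X_NP L (mesh_triangles n xs ys dg)) \<and>
        (\<forall>I J. \<phi> I (node J) = (if I = J then 1 else 0)))"

definition M_mat :: "real \<Rightarrow> ('N::finite \<Rightarrow> real \<times> real \<Rightarrow> real) \<Rightarrow> real ^ 'N ^ 'N" where
  "M_mat L \<phi> = (\<chi> I J. L2_inner L (\<phi> I) (\<phi> J))"

definition K_mat :: "real \<Rightarrow> ('N::finite \<Rightarrow> real \<times> real \<Rightarrow> real) \<Rightarrow> real ^ 'N ^ 'N" where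
  "K_mat L \<phi> = (\<chi> I J. H1_inner L (\<phi> I) (\<phi> J))"

text \<open>The argument \<open>g\<close> is the weak gradient of \<open>p\<close>.\<close>

definition R_mat ::
    "real \<Rightarrow> (real \<times> real \<Rightarrow> real \<times> real) \<Rightarrow> ('N::finite \<Rightarrow> real \<times> real \<Rightarrow> real) \<Rightarrow> real ^ 'N ^ 'N" where
  "R_mat L g \<phi> = (\<chi> I J. L2_inner L (\<lambda>z. Vrot g z \<bullet> grad (\<phi> J) z) (\<phi> I))"

definition S_mat ::
    "real \<Rightarrow> ('N::finite \<Rightarrow> real \<times> real \<Rightarrow> real) \<Rightarrow> real ^ 'N \<Rightarrow> real ^ 'N ^ 'N" where
  "S_mat L \<phi> U =
     (\<chi> I J. - L2_inner L (\<lambda>z. Vrot (grad (\<lambda>w. \<Sum>l\<in>UNIV. U $ l * \<phi> l w)) z \<bullet> grad (\<phi> I) z) (\<phi> J))"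

definition mat_nrm :: "real ^ 'N ^ 'N \<Rightarrow> real ^ 'N \<Rightarrow> real" where
  "mat_nrm M a = sqrt (a \<bullet> (M *v a))"

definition block_mat ::
    "real ^ 'n ^ 'm \<Rightarrow> real ^ 'k ^ 'm \<Rightarrow> real ^ 'n ^ 'l \<Rightarrow> real ^ 'k ^ 'l \<Rightarrow> real ^ ('n + 'k) ^ ('m + 'l)" where
  "block_mat A B C D = (\<chi> i j. case i of
      Inl a \<Rightarrow> (case j of Inl b \<Rightarrow> A $ a $ b | Inr b \<Rightarrow> B $ a $ b)
    | Inr a \<Rightarrow> (case j of Inl b \<Rightarrow> C $ a $ b | Inr b \<Rightarrow> D $ a $ b))"

definition block_vec :: "real ^ 'm \<Rightarrow> real ^ 'l \<Rightarrow> real ^ ('m + 'l)" where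
  "block_vec a b = (\<chi> i. case i of Inl k \<Rightarrow> a $ k | Inr k \<Rightarrow> b $ k)"

end

theory Submission imports Defs begin

text \<open>The system is square, so it suffices that the homogeneous one has only the trivial
  solution.  Let \<open>v\<close>, \<open>w\<close> be the functions with coefficients \<open>\<beta>\<close>, \<open>\<alpha>\<close>.  The second block row
  tested with \<open>\<alpha>\<close> bounds the \<open>H\<^sup>1\<close> norm of \<open>w\<close> by the \<open>L\<^sup>2\<close> norm of \<open>v\<close>; the first one tested
  with \<open>\<beta>\<close> gives \<open>\<langle>v, v\<rangle> = \<tau> \<langle>V(p) \<cdot> \<nabla>w, v\<rangle>\<close>, because \<open>\<beta>\<^sup>T S(U) \<beta> = 0\<close>.  As \<open>\<tau>\<close> times each
  component of \<open>V(p)\<close> is at most \<open>1/4\<close>, Young's inequality forces \<open>v = 0\<close> and then \<open>w = 0\<close>.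
  The identity \<open>\<beta>\<^sup>T S(U) \<beta> = 0\<close> is a discrete divergence theorem: on each triangle the integral of
  \<open>V(u) \<cdot> \<nabla>(v\<^sup>2/2)\<close> is a sum of edge terms depending only on the values of \<open>u\<close> and \<open>v\<close> at the end
  points; they cancel across inner edges, and across opposite sides of the square by periodicity.\<close>

section \<open>Integrals over right triangles\<close>

text \<open>The legs \<open>p\<close> and \<open>q\<close> may be negative, which covers all four orientations of a mesh triangle.\<close>

definition right_triangle :: "real \<times> real \<Rightarrow> real \<Rightarrow> real \<Rightarrow> (real \<times> real) set" where
  "right_triangle c p q = {z. 0 < (fst z - fst c) / p \<and> 0 < (snd z - snd c) / q \<and>
     (fst z - fst c) / p + (snd z - snd c) / q < 1}"

definition closed_triangle :: "real \<times> real \<Rightarrow> real \<Rightarrow> real \<Rightarrow> (real \<times> real) set" where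
  "closed_triangle c p q = convex hull {c, c + (p, 0), c + (0, q)}"

lemma open_right_triangle: "open (right_triangle c p q)"
  unfolding right_triangle_def divide_inverse
  by (intro open_Collect_conj open_Collect_less continuous_intros)

lemma right_triangle_subset_closed:
  assumes "p \<noteq> 0" "q \<noteq> 0"
  shows "right_triangle c p q \<subseteq> closed_triangle c p q"
proof
  fix z assume "z \<in> right_triangle c p q"
  define s t where "s = (fst z - fst c) / p" and "t = (snd z - snd c) / q"
  have "0 \<le> s" "0 \<le> t" "0 \<le> 1 - s - t"
    using \<open>z \<in> _\<close> by (auto simp: right_triangle_def s_def t_def)
  moreover have "z = (1 - s - t) *\<^sub>R c + s *\<^sub>R (c + (p, 0)) + t *\<^sub>R (c + (0, q))"
    using assms by (auto simp: prod_eq_iff s_def t_def field_simps)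
  ultimately show "z \<in> closed_triangle c p q"
    unfolding closed_triangle_def convex_hull_3 by (smt (verit) mem_Collect_eq)
qed

text \<open>The zero extension to the plane makes Fubini applicable: the slice at \<open>x\<close>
  is an interval of length \<open>1 - x\<close>, and both iterated integrals follow from explicit
  antiderivatives.\<close>

lemma integral_affine_unit_triangle:
  fixes a b c :: real
  defines "f \<equiv> \<lambda>z :: real \<times> real. if z \<in> right_triangle 0 1 1 then a * fst z + b * snd z + c else 0"
  shows "integrable lborel f" "integral\<^sup>L lborel f = a / 6 + b / 6 + c / 2"
proof -
  have meas: "f \<in> borel_measurable borel"
    unfolding f_def
    by (intro measurable_If_set borel_measurable_continuous_onI continuous_intros)
       (simp_all add: open_right_triangle borel_open)
  \<comment> \<open>The constant \<open>\<bar>a\<bar> + \<bar>b\<bar> + \<bar>c\<bar>\<close>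
    dominates the integrand because the triangle lies in the unit square.\<close>
  have "integrable lborel (\<lambda>z. indicator (cbox (0,0) (1,1)) z *\<^sub>R (\<bar>a\<bar> + \<bar>b\<bar> + \<bar>c\<bar>))"
    by (intro integrable_scaleR_left) (simp add: integrable_indicator_iff emeasure_lborel_cbox_eq)
  then show int: "integrable lborel f"
  proof (rule Bochner_Integration.integrable_bound)
    show "f \<in> borel_measurable lborel" using meas by simp
    have "norm (f z) \<le> norm (indicator (cbox (0,0) (1,1)) z *\<^sub>R (\<bar>a\<bar> + \<bar>b\<bar> + \<bar>c\<bar>))" for z
    proof (cases "z \<in> right_triangle 0 1 1")
      case True
      then have z: "0 < fst z" "0 < snd z" "fst z < 1" "snd z < 1"
        by (auto simp: right_triangle_def)
      then have "z \<in> cbox (0,0) (1,1)" by (cases z) (simp add: cbox_Pair_eq)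
      moreover have "\<bar>a * fst z\<bar> \<le> \<bar>a\<bar>" "\<bar>b * snd z\<bar> \<le> \<bar>b\<bar>"
        using z by (simp_all add: abs_mult mult_left_le)
      ultimately show ?thesis using True by (simp add: f_def)
    qed (simp add: f_def)
    then show "AE z in lborel. norm (f z) \<le> norm (indicator (cbox (0,0) (1,1)) z *\<^sub>R (\<bar>a\<bar> + \<bar>b\<bar> + \<bar>c\<bar>))"
      by simp
  qed
  have inner: "(LBINT y. f (x, y)) = indicator {0<..<1} x *\<^sub>R ((a * x + c) * (1 - x) + b * (1 - x)\<^sup>2 / 2)" for x
  proof (cases "0 < x \<and> x < 1")
    case True
    have "(LBINT y. f (x, y)) = (LBINT y. indicator {0..1-x} y *\<^sub>R (a * x + b * y + c))"
    proof (rule integral_cong_AE)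
      \<comment> \<open>Passing to a closed interval, as the fundamental theorem of calculus
        requires, changes the integrand at most at the two end points.\<close>
      show "AE y in lborel. f (x, y) = indicator {0..1-x} y *\<^sub>R (a * x + b * y + c)"
        using AE_lborel_singleton[of 0] AE_lborel_singleton[of "1 - x"]
        by eventually_elim (use True in \<open>auto simp: f_def right_triangle_def indicator_def\<close>)
      show "(\<lambda>y. f (x, y)) \<in> borel_measurable lborel" using meas by measurable
    qed measurable
    also have "\<dots> = ((a * x + c) * (1 - x) + b * (1 - x)\<^sup>2 / 2) - ((a * x + c) * 0 + b * 0\<^sup>2 / 2)"
      using True
      by (intro integral_FTC_atLeastAtMost[where F = "\<lambda>y. (a * x + c) * y + b * y\<^sup>2 / 2"])
         (auto intro!: derivative_eq_intros continuous_intros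
           simp: has_real_derivative_iff_has_vector_derivative[symmetric])
    finally show ?thesis using True by simp
  next
    case False
    then have "f (x, y) = 0" for y by (auto simp: f_def right_triangle_def)
    with False show ?thesis by (auto simp: indicator_def)
  qed
  have "integral\<^sup>L lborel f = (LBINT x. LBINT y. f (x, y))"
    using lborel_pair.integral_fst'[of f] int by (simp add: lborel_prod)
  also have "\<dots> = (LBINT x. indicator {0..1} x *\<^sub>R ((a * x + c) * (1 - x) + b * (1 - x)\<^sup>2 / 2))"
    unfolding inner
  proof (rule integral_cong_AE)
    show "AE x in lborel. indicator {0<..<1} x *\<^sub>R ((a * x + c) * (1 - x) + b * (1 - x)\<^sup>2 / 2) =
        indicator {0..1} x *\<^sub>R ((a * x + c) * (1 - x) + b * (1 - x)\<^sup>2 / 2)"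
      using AE_lborel_singleton[of 0] AE_lborel_singleton[of 1]
      by eventually_elim (auto simp: indicator_def)
  qed measurable
  also have "\<dots> = (a * (1\<^sup>2 / 2 - 1 ^ 3 / 3) + c * (1 - 1\<^sup>2 / 2) - b * (1 - 1) ^ 3 / 6)
      - (a * (0\<^sup>2 / 2 - 0 ^ 3 / 3) + c * (0 - 0\<^sup>2 / 2) - b * (1 - 0) ^ 3 / 6)"
    by (intro integral_FTC_atLeastAtMost[where
          F = "\<lambda>x. a * (x\<^sup>2 / 2 - x ^ 3 / 3) + c * (x - x\<^sup>2 / 2) - b * (1 - x) ^ 3 / 6"])
       (auto intro!: derivative_eq_intros continuous_intros
         simp: has_real_derivative_iff_has_vector_derivative[symmetric] field_simps power2_eq_square)
  finally show "integral\<^sup>L lborel f = a / 6 + b / 6 + c / 2"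
    by simp
qed

text \<open>The affine map from the unit triangle has Jacobian \<open>\<bar>p * q\<bar>\<close>. The
  value is the area times the mean of the three vertex values, a rule that is exact for affine
  integrands.\<close>

lemma has_integral_affine_right_triangle:
  assumes "p \<noteq> 0" "q \<noteq> 0"
  shows "((\<lambda>z. a \<bullet> z + k) has_integral \<bar>p * q\<bar> / 6 *
      ((a \<bullet> c + k) + (a \<bullet> (c + (p, 0)) + k) + (a \<bullet> (c + (0, q)) + k))) (right_triangle c p q)"
proof -
  define F where "F = (\<lambda>z. if z \<in> right_triangle c p q then a \<bullet> z + k else 0)"
  \<comment> \<open>\<open>Basis\<close> consists of \<open>(1, 0)\<close> and
    \<open>(0, 1)\<close>, so the else branch is the scaling of the second coordinate.\<close>
  define m where "m = (\<lambda>j :: real \<times> real. if j = (1, 0) then p else q)"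
  define T where "T = (\<lambda>z. c + (\<Sum>j\<in>Basis. (m j * (z \<bullet> j)) *\<^sub>R j))"
  define f where "f = (\<lambda>z :: real \<times> real. if z \<in> right_triangle 0 1 1
      then fst a * p * fst z + snd a * q * snd z + (a \<bullet> c + k) else 0)"
  have lb: "lborel = density (distr lborel borel T) (\<lambda>_. ennreal \<bar>p * q\<bar>)"
    using lborel_affine_euclidean[of m c] assms
    by (simp add: T_def m_def Basis_prod_def abs_mult mult.commute split: if_splits)
  have T: "T z = (fst c + p * fst z, snd c + q * snd z)" for z
    by (simp add: T_def m_def Basis_prod_def prod_eq_iff inner_prod_def)
  have [measurable]: "T \<in> borel_measurable borel"
    unfolding T_def by (intro borel_measurable_continuous_onI continuous_intros)
  have [measurable]: "F \<in> borel_measurable borel" unfolding F_def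
    by (intro measurable_If_set borel_measurable_continuous_onI continuous_intros)
       (simp_all add: open_right_triangle borel_open)
  have "T z \<in> right_triangle c p q \<longleftrightarrow> z \<in> right_triangle 0 1 1" for z
    using assms by (simp add: T right_triangle_def)
  then have FT: "F (T z) = f z" for z
    by (simp add: F_def f_def T inner_prod_def algebra_simps)
  have "integrable lborel F"
    by (subst lb) (simp add: integrable_density integrable_distr_eq FT
        integral_affine_unit_triangle f_def)
  moreover have "integral\<^sup>L lborel F = \<bar>p * q\<bar> * integral\<^sup>L lborel f"
    by (subst lb) (simp add: integral_density integral_distr FT)
  ultimately have "(F has_integral \<bar>p * q\<bar> * (fst a * p / 6 + snd a * q / 6 + (a \<bullet> c + k) / 2)) UNIV"
    using has_integral_integral_lborel[of F]
    by (simp add: f_def integral_affine_unit_triangle)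
  moreover have "\<bar>p * q\<bar> * (fst a * p / 6 + snd a * q / 6 + (a \<bullet> c + k) / 2) =
      \<bar>p * q\<bar> / 6 * ((a \<bullet> c + k) + (a \<bullet> (c + (p, 0)) + k) + (a \<bullet> (c + (0, q)) + k))"
    by (simp add: inner_prod_def algebra_simps)
  ultimately show ?thesis
    unfolding F_def has_integral_restrict_UNIV by simp
qed

section \<open>Gradients of affine functions and fluxes along edges\<close>

lemma grad_affine:
  assumes "open S" "z \<in> S" "\<And>w. w \<in> S \<Longrightarrow> u w = a \<bullet> w + k"
  shows "grad u z = a"
proof -
  \<comment> \<open>\<open>deriv\<close> only sees values near the point; the open set
    \<open>S\<close>, pulled back to an axis-parallel line, supplies such a neighbourhood.\<close>
  have "((\<lambda>x. u (x, snd z)) has_field_derivative fst a) (at (fst z))"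
  proof (rule has_field_derivative_transform_within_open)
    show "((\<lambda>x. a \<bullet> (x, snd z) + k) has_field_derivative fst a) (at (fst z))"
      by (auto simp: inner_prod_def intro!: derivative_eq_intros)
    show "open ((\<lambda>x. (x, snd z)) -` S)"
      by (intro open_vimage assms continuous_intros)
  qed (use assms in auto)
  moreover have "((\<lambda>y. u (fst z, y)) has_field_derivative snd a) (at (snd z))"
  proof (rule has_field_derivative_transform_within_open)
    show "((\<lambda>y. a \<bullet> (fst z, y) + k) has_field_derivative snd a) (at (snd z))"
      by (auto simp: inner_prod_def intro!: derivative_eq_intros)
    show "open ((\<lambda>y. (fst z, y)) -` S)"
      by (intro open_vimage assms continuous_intros)
  qed (use assms in auto)
  ultimately show ?thesis
    by (simp add: grad_def DERIV_imp_deriv)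
qed

text \<open>The integral of \<open>b\<^sup>2/2\<close> with respect to \<open>du\<close> along the segment from \<open>z\<close> to \<open>w\<close>,
  for \<open>u\<close> and \<open>b\<close> affine on it.\<close>

definition edge_flux :: "(real \<times> real \<Rightarrow> real) \<Rightarrow> (real \<times> real \<Rightarrow> real) \<Rightarrow> real \<times> real \<Rightarrow> real \<times> real \<Rightarrow> real" where
  "edge_flux u b z w = (u w - u z) * ((b z)\<^sup>2 + b z * b w + (b w)\<^sup>2) / 6"

lemma edge_flux_flip: "edge_flux u b w z = - edge_flux u b z w"
  by (simp add: edge_flux_def field_simps)

text \<open>The rotated product is the constant Jacobian determinant \<open>J\<close> of
  \<open>(u, b)\<close>, so the vertex rule integrates it against \<open>b\<close> exactly. The
  result is the flux along the boundary traversed clockwise: the listed order of vertices is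
  clockwise for \<open>p * q > 0\<close>, and \<open>sgn\<close> corrects it otherwise.\<close>

lemma has_integral_triangle_flux:
  assumes "p \<noteq> 0" "q \<noteq> 0"
    and u: "\<And>z. z \<in> closed_triangle c p q \<Longrightarrow> u z = a \<bullet> z + k"
    and b: "\<And>z. z \<in> closed_triangle c p q \<Longrightarrow> b z = a' \<bullet> z + k'"
  shows "((\<lambda>z. (Vrot (grad u) z \<bullet> grad b z) * b z) has_integral
      sgn (p * q) * (edge_flux u b (c + (p, 0)) c + edge_flux u b c (c + (0, q))
        + edge_flux u b (c + (0, q)) (c + (p, 0)))) (right_triangle c p q)"
proof -
  note sub = right_triangle_subset_closed[OF assms(1,2), of c]
  define J where "J = fst a * snd a' - snd a * fst a'"
  have g: "grad u z = a" "grad b z = a'" if "z \<in> right_triangle c p q" for z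
    by (rule grad_affine[OF open_right_triangle that]; use u b sub in blast)+
  have v: "u c = a \<bullet> c + k" "u (c + (p, 0)) = a \<bullet> c + fst a * p + k"
    "u (c + (0, q)) = a \<bullet> c + snd a * q + k"
    "b c = a' \<bullet> c + k'" "b (c + (p, 0)) = a' \<bullet> c + fst a' * p + k'"
    "b (c + (0, q)) = a' \<bullet> c + snd a' * q + k'"
    using u[of c] u[of "c + (p, 0)"] u[of "c + (0, q)"] b[of c] b[of "c + (p, 0)"] b[of "c + (0, q)"]
    by (simp_all add: closed_triangle_def hull_inc inner_prod_def algebra_simps)
  have "((\<lambda>z. J * (a' \<bullet> z + k')) has_integral J * (\<bar>p * q\<bar> / 6 *
      ((a' \<bullet> c + k') + (a' \<bullet> (c + (p, 0)) + k') + (a' \<bullet> (c + (0, q)) + k')))) (right_triangle c p q)"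
    by (intro has_integral_mult_right has_integral_affine_right_triangle assms)
  also have "J * (\<bar>p * q\<bar> / 6 *
      ((a' \<bullet> c + k') + (a' \<bullet> (c + (p, 0)) + k') + (a' \<bullet> (c + (0, q)) + k'))) =
      sgn (p * q) * (J * (p * q) / 6 * (3 * (a' \<bullet> c + k') + fst a' * p + snd a' * q))"
    by (simp add: inner_prod_def algebra_simps abs_sgn)
  \<comment> \<open>A polynomial identity after inserting the vertex values \<open>v\<close>; the
    constant term of \<open>u\<close> drops out through the differences in
    \<open>edge_flux\<close>.\<close>
  also have "J * (p * q) / 6 * (3 * (a' \<bullet> c + k') + fst a' * p + snd a' * q) =
      edge_flux u b (c + (p, 0)) c + edge_flux u b c (c + (0, q))
        + edge_flux u b (c + (0, q)) (c + (p, 0))"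
    unfolding edge_flux_def v J_def by (simp add: field_simps power2_eq_square)
  finally show ?thesis
    by (rule has_integral_eq[rotated]) (use b sub in \<open>auto simp: g Vrot_def inner_prod_def J_def\<close>)
qed

section \<open>The mesh\<close>

lemma lmeasurable_Omega: "Omega L \<in> lmeasurable"
  unfolding Omega_def by (intro lmeasurable_open bounded_Times open_Times) auto

text \<open>The mesh lists vertices by compass position while \<open>closed_triangle\<close> starts
  at the right angle; these permutations help to reconcile the two.\<close>

lemma insert_3_rotate: "{a, b, c} = {c, a, b}"
  and insert_3_rev: "{a, b, c} = {c, b, a}"
  by auto

locale square_mesh =
  fixes L :: real and n :: nat and xs ys :: "nat \<Rightarrow> real" and dg :: "nat \<Rightarrow> nat \<Rightarrow> bool"
  assumes L: "0 < L" and n: "2 \<le> n" and grid: "tensor_grid L n xs ys"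
begin

abbreviation "\<T> \<equiv> mesh_triangles n xs ys dg"

lemma xs_less: "i < j \<Longrightarrow> j < n \<Longrightarrow> xs i < xs j"
  and ys_less: "i < j \<Longrightarrow> j < n \<Longrightarrow> ys i < ys j"
  using grid by (auto simp: tensor_grid_def strict_mono_on_def)

lemma xs_le: "i \<le> j \<Longrightarrow> j < n \<Longrightarrow> xs i \<le> xs j"
  and ys_le: "i \<le> j \<Longrightarrow> j < n \<Longrightarrow> ys i \<le> ys j"
  using xs_less[of i j] ys_less[of i j] by (cases "i = j"; force)+

lemma grid_ends: "xs 0 = 0" "xs (n - 1) = L" "ys 0 = 0" "ys (n - 1) = L"
  using grid by (auto simp: tensor_grid_def)

lemma xs_step: "i < n - 1 \<Longrightarrow> xs i < xs (Suc i)"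
  and ys_step: "j < n - 1 \<Longrightarrow> ys j < ys (Suc j)"
  by (auto intro: xs_less ys_less)

lemma xs_range: "i < n \<Longrightarrow> xs i \<in> {0..L}"
  and ys_range: "i < n \<Longrightarrow> ys i \<in> {0..L}"
  using xs_le[of 0 i] xs_le[of i "n - 1"] ys_le[of 0 i] ys_le[of i "n - 1"] n
  unfolding grid_ends by auto

text \<open>If the diagonal runs from south-west to north-east, the right angle of the lower half is
  at the south-east corner, otherwise at the south-west one; the signed legs start there.
  \<open>upper\<close> has its right angle at the opposite corner of the cell.\<close>

definition lower :: "nat \<Rightarrow> nat \<Rightarrow> (real \<times> real) set" where
  "lower i j = (if dg i j
     then right_triangle (xs (Suc i), ys j) (xs i - xs (Suc i)) (ys (Suc j) - ys j)
     else right_triangle (xs i, ys j) (xs (Suc i) - xs i) (ys (Suc j) - ys j))"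

definition upper :: "nat \<Rightarrow> nat \<Rightarrow> (real \<times> real) set" where
  "upper i j = (if dg i j
     then right_triangle (xs i, ys (Suc j)) (xs (Suc i) - xs i) (ys j - ys (Suc j))
     else right_triangle (xs (Suc i), ys (Suc j)) (xs i - xs (Suc i)) (ys j - ys (Suc j)))"

lemma cell_triangles_in_mesh:
  assumes "i < n - 1" "j < n - 1" "K \<in> cell_triangles xs ys dg i j"
  shows "K \<in> \<T>"
proof -
  have "K \<in> (\<Union>j'<n - 1. cell_triangles xs ys dg i j')"
    using assms(2,3) by (rule UN_I[OF lessThan_iff[THEN iffD2]])
  with assms(1) show ?thesis
    unfolding mesh_triangles_def by (rule UN_I[OF lessThan_iff[THEN iffD2]])
qed

text \<open>These are the closed versions of the two forms of \<open>lower\<close>, followed by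
  those of the two forms of \<open>upper\<close>.\<close>

lemma closed_triangle_in_mesh:
  assumes "i < n - 1" "j < n - 1"
  shows "dg i j \<Longrightarrow> closed_triangle (xs (Suc i), ys j) (xs i - xs (Suc i)) (ys (Suc j) - ys j) \<in> \<T>"
    and "\<not> dg i j \<Longrightarrow> closed_triangle (xs i, ys j) (xs (Suc i) - xs i) (ys (Suc j) - ys j) \<in> \<T>"
    and "dg i j \<Longrightarrow> closed_triangle (xs i, ys (Suc j)) (xs (Suc i) - xs i) (ys j - ys (Suc j)) \<in> \<T>"
    and "\<not> dg i j \<Longrightarrow> closed_triangle (xs (Suc i), ys (Suc j)) (xs i - xs (Suc i)) (ys j - ys (Suc j)) \<in> \<T>"
proof -
  note cell = cell_triangles_in_mesh[OF assms]
  {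
    assume dg: "dg i j"
    have "convex hull {(xs (Suc i), ys j), (xs i, ys j), (xs (Suc i), ys (Suc j))} \<in> \<T>"
      by (rule cell, subst insert_commute) (simp add: cell_triangles_def Let_def dg)
    then show "closed_triangle (xs (Suc i), ys j) (xs i - xs (Suc i)) (ys (Suc j) - ys j) \<in> \<T>"
      by (simp add: closed_triangle_def)
    have "convex hull {(xs i, ys (Suc j)), (xs (Suc i), ys (Suc j)), (xs i, ys j)} \<in> \<T>"
      by (rule cell, subst insert_3_rotate) (simp add: cell_triangles_def Let_def dg)
    then show "closed_triangle (xs i, ys (Suc j)) (xs (Suc i) - xs i) (ys j - ys (Suc j)) \<in> \<T>"
      by (simp add: closed_triangle_def)
  next
    assume dg: "\<not> dg i j"
    have "convex hull {(xs i, ys j), (xs (Suc i), ys j), (xs i, ys (Suc j))} \<in> \<T>"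
      by (rule cell) (simp add: cell_triangles_def Let_def dg)
    then show "closed_triangle (xs i, ys j) (xs (Suc i) - xs i) (ys (Suc j) - ys j) \<in> \<T>"
      by (simp add: closed_triangle_def)
    have "convex hull {(xs (Suc i), ys (Suc j)), (xs i, ys (Suc j)), (xs (Suc i), ys j)} \<in> \<T>"
      by (rule cell, subst insert_3_rev) (simp add: cell_triangles_def Let_def dg)
    then show "closed_triangle (xs (Suc i), ys (Suc j)) (xs i - xs (Suc i)) (ys j - ys (Suc j)) \<in> \<T>"
      by (simp add: closed_triangle_def)
  }
qed

lemma X_N_affine:
  assumes "u \<in> X_N L \<T>" "K \<in> \<T>"
  obtains a c where "\<And>z. z \<in> K \<Longrightarrow> u z = a \<bullet> z + c"
proof -
  have "\<exists>a c. \<forall>z\<in>K. u z = a \<bullet> z + c" using assms by (simp add: X_N_def)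
  then show ?thesis using that by blast
qed

section \<open>Cells, their inner points and the null set of edges\<close>

definition cell :: "nat \<times> nat \<Rightarrow> (real \<times> real) set" where
  "cell = (\<lambda>(i, j). lower i j \<union> upper i j)"

definition cells :: "(nat \<times> nat) set" where
  "cells = {..<n - 1} \<times> {..<n - 1}"

text \<open>A cell contains neither its boundary nor its diagonal, so these are the points of the
  square off all edges, where piecewise affine functions are differentiable.\<close>

definition inner_points :: "(real \<times> real) set" where
  "inner_points = \<Union> (cell ` cells)"

lemma finite_cells: "finite cells"
  by (simp add: cells_def)

lemma open_cell: "open (cell k)"
  by (auto simp: cell_def lower_def upper_def open_right_triangle split: prod.splits)

lemma open_inner_points: "open inner_points"
  by (auto simp: inner_points_def open_cell)

text \<open>\<open>s\<close> and \<open>t\<close> map the cell to the unit square. A leg running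
  westwards replaces \<open>s\<close> by \<open>1 - s\<close>, whence \<open>t < s\<close> for one
  diagonal and \<open>s + t < 1\<close> for the other.\<close>

lemma mem_lower:
  fixes i j :: nat and z :: "real \<times> real"
  defines "s \<equiv> (fst z - xs i) / (xs (Suc i) - xs i)" and "t \<equiv> (snd z - ys j) / (ys (Suc j) - ys j)"
  assumes "i < n - 1" "j < n - 1"
  shows "z \<in> lower i j \<longleftrightarrow> (if dg i j then s < 1 \<and> 0 < t \<and> t < s else 0 < s \<and> 0 < t \<and> s + t < 1)"
proof -
  have "(fst z - xs (Suc i)) / (xs i - xs (Suc i)) = 1 - s"
    using xs_step[OF assms(3)] by (simp add: s_def field_simps)
  then show ?thesis
    by (auto simp: lower_def right_triangle_def s_def[symmetric] t_def[symmetric])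
qed

lemma mem_upper:
  fixes i j :: nat and z :: "real \<times> real"
  defines "s \<equiv> (fst z - xs i) / (xs (Suc i) - xs i)" and "t \<equiv> (snd z - ys j) / (ys (Suc j) - ys j)"
  assumes "i < n - 1" "j < n - 1"
  shows "z \<in> upper i j \<longleftrightarrow> (if dg i j then 0 < s \<and> t < 1 \<and> s < t else s < 1 \<and> t < 1 \<and> 1 < s + t)"
proof -
  have "(fst z - xs (Suc i)) / (xs i - xs (Suc i)) = 1 - s"
    using xs_step[OF assms(3)] by (simp add: s_def field_simps)
  moreover have "(snd z - ys (Suc j)) / (ys j - ys (Suc j)) = 1 - t"
    using ys_step[OF assms(4)] by (simp add: t_def field_simps)
  ultimately show ?thesis
    by (auto simp: upper_def right_triangle_def s_def[symmetric] t_def[symmetric])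
qed

lemma lower_upper_disjoint:
  assumes "i < n - 1" "j < n - 1"
  shows "lower i j \<inter> upper i j = {}"
  using mem_lower[OF assms] mem_upper[OF assms] by (auto split: if_splits)

lemma cell_subset:
  assumes "(i, j) \<in> cells"
  shows "cell (i, j) \<subseteq> {xs i<..<xs (Suc i)} \<times> {ys j<..<ys (Suc j)}"
proof
  fix z assume z: "z \<in> cell (i, j)"
  have ij: "i < n - 1" "j < n - 1" using assms by (auto simp: cells_def)
  define s t where "s = (fst z - xs i) / (xs (Suc i) - xs i)" and "t = (snd z - ys j) / (ys (Suc j) - ys j)"
  have "0 < s" "s < 1" "0 < t" "t < 1"
    using z mem_lower[OF ij] mem_upper[OF ij] by (auto simp: cell_def s_def t_def split: if_splits)
  then show "z \<in> {xs i<..<xs (Suc i)} \<times> {ys j<..<ys (Suc j)}"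
    using xs_step[OF ij(1)] ys_step[OF ij(2)]
    by (cases z) (auto simp: s_def t_def field_simps)
qed

text \<open>Distinct index pairs differ in the column or, within one column, in the row;
  monotonicity of the nodes then puts a grid line between the two enclosing open boxes.\<close>

lemma cells_disjoint:
  assumes "k \<in> cells" "k' \<in> cells" "k \<noteq> k'"
  shows "cell k \<inter> cell k' = {}"
proof -
  obtain i j i' j' where k: "k = (i, j)" "k' = (i', j')" by (cases k, cases k')
  have ij: "i < n - 1" "j < n - 1" "i' < n - 1" "j' < n - 1"
    using assms by (auto simp: cells_def k)
  have "xs (Suc i) \<le> xs i' \<or> xs (Suc i') \<le> xs i \<or> ys (Suc j) \<le> ys j' \<or> ys (Suc j') \<le> ys j"
  proof (cases "i = i'")
    case True
    then have "j < j' \<or> j' < j" using assms(3) k by auto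
    then show ?thesis using ij by (auto intro: ys_le)
  next
    case False
    then have "i < i' \<or> i' < i" by auto
    then show ?thesis using ij by (auto intro: xs_le)
  qed
  then show ?thesis
    using cell_subset[of i j] cell_subset[of i' j'] assms(1,2) unfolding k by force
qed

lemma inner_points_subset: "inner_points \<subseteq> Omega L"
proof
  fix z assume "z \<in> inner_points"
  then obtain i j where ij: "(i, j) \<in> cells" "z \<in> cell (i, j)"
    by (auto simp: inner_points_def)
  with cell_subset[OF ij(1)] have "z \<in> {xs i<..<xs (Suc i)} \<times> {ys j<..<ys (Suc j)}" by auto
  moreover have "i < n" "Suc i < n" "j < n" "Suc j < n" using ij(1) by (auto simp: cells_def)
  ultimately show "z \<in> Omega L"
    using xs_range[of i] xs_range[of "Suc i"] ys_range[of j] ys_range[of "Suc j"]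
    by (cases z) (auto simp: Omega_def)
qed

text \<open>Locates one coordinate of a point in its grid interval. In the induction, a value not
  below \<open>f m\<close> must lie in the last interval.\<close>

lemma between_consecutive:
  fixes f :: "nat \<Rightarrow> real"
  assumes "f 0 \<le> x" "x < f m"
  shows "\<exists>i<m. f i \<le> x \<and> x < f (Suc i)"
  using assms
proof (induction m)
  case (Suc m)
  show ?case
  proof (cases "x < f m")
    case True
    with Suc show ?thesis using less_Suc_eq by blast
  next
    case False
    with Suc.prems show ?thesis by (intro exI[of _ m]) simp
  qed
qed simp

text \<open>The missing points lie on finitely many lines: the grid lines and the lines carrying the
  diagonals.\<close>

lemma negligible_outside_inner_points: "negligible (Omega L - inner_points)"
proof -
  \<comment> \<open>The diagonal of a cell, extended to a full line and written with a normal
    vector, as \<open>negligible_hyperplane\<close> expects.\<close>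
  define D where "D i j = (if dg i j
      then {z. (ys (Suc j) - ys j, - (xs (Suc i) - xs i)) \<bullet> z =
        (ys (Suc j) - ys j) * xs i - (xs (Suc i) - xs i) * ys j}
      else {z. (ys (Suc j) - ys j, xs (Suc i) - xs i) \<bullet> z =
        (ys (Suc j) - ys j) * xs i + (xs (Suc i) - xs i) * ys (Suc j)})" for i j
  define N where "N = (\<Union>i<n. {z :: real \<times> real. (1, 0) \<bullet> z = xs i}) \<union>
     (\<Union>j<n. {z :: real \<times> real. (0, 1) \<bullet> z = ys j}) \<union> (\<Union>i<n - 1. \<Union>j<n - 1. D i j)"
  have "negligible (D i j)" if "i < n - 1" "j < n - 1" for i j
    using xs_step[OF that(1)] ys_step[OF that(2)]
    by (auto simp: D_def zero_prod_def intro!: negligible_hyperplane)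
  then have "negligible N"
    unfolding N_def
    by (intro negligible_Un negligible_Union) (auto simp: zero_prod_def intro!: negligible_hyperplane negligible_Union)
  moreover have "Omega L - inner_points \<subseteq> N"
  proof (rule subsetI, rule ccontr)
    fix z assume z: "z \<in> Omega L - inner_points" "z \<notin> N"
    then have "0 < fst z" "fst z < L" "0 < snd z" "snd z < L" by (auto simp: Omega_def)
    then obtain i j where ij: "i < n - 1" "xs i \<le> fst z" "fst z < xs (Suc i)"
        "j < n - 1" "ys j \<le> snd z" "snd z < ys (Suc j)"
      using between_consecutive[of xs "fst z" "n - 1"] between_consecutive[of ys "snd z" "n - 1"]
      unfolding grid_ends by auto
    have "fst z \<noteq> xs i" "snd z \<noteq> ys j" "z \<notin> D i j"
      using z(2) ij(1,4) by (auto simp: N_def inner_prod_def)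
    define s t where "s = (fst z - xs i) / (xs (Suc i) - xs i)" and "t = (snd z - ys j) / (ys (Suc j) - ys j)"
    have st: "0 < s" "s < 1" "0 < t" "t < 1"
      using ij \<open>fst z \<noteq> xs i\<close> \<open>snd z \<noteq> ys j\<close> by (auto simp: s_def t_def field_simps)
    \<comment> \<open>In cell coordinates the line \<open>D i j\<close> is the diagonal
      \<open>s = t\<close> or the antidiagonal \<open>s + t = 1\<close> of the unit square.\<close>
    have "if dg i j then s \<noteq> t else s + t \<noteq> 1"
      using \<open>z \<notin> D i j\<close> ij xs_step[OF ij(1)] ys_step[OF ij(4)]
      by (auto simp: D_def s_def t_def inner_prod_def field_simps split: if_splits)
    then have "z \<in> cell (i, j)"
      using mem_lower[OF ij(1,4), of z] mem_upper[OF ij(1,4), of z] st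
      unfolding s_def[symmetric] t_def[symmetric] cell_def by (auto split: if_splits)
    then show False
      using z(1) ij(1,4) by (auto simp: inner_points_def cells_def)
  qed
  ultimately show ?thesis
    using negligible_subset by blast
qed

text \<open>Lets integrands be compared inside the triangles only, whatever the values of
  \<open>deriv\<close> on the edges are.\<close>

lemma AE_inner_points: "AE z in lebesgue_on (Omega L). z \<in> inner_points"
proof -
  have "AE z in lebesgue. z \<notin> Omega L - inner_points"
    using negligible_outside_inner_points by (intro AE_not_in) (simp add: negligible_iff_null_sets)
  then show ?thesis
    by (subst AE_restrict_space_iff) (auto simp: lmeasurable_Omega fmeasurableD)
qed

text \<open>Open counterparts of the members of \<open>\<T>\<close>: openness allows
  \<open>grad\<close> to be read off the affine formula.\<close>

definition triangles :: "(real \<times> real) set set" where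
  "triangles = (\<lambda>(i, j). lower i j) ` cells \<union> (\<lambda>(i, j). upper i j) ` cells"

lemma finite_triangles: "finite triangles"
  by (simp add: triangles_def finite_cells)

lemma inner_points_eq: "inner_points = \<Union> triangles"
  by (force simp: inner_points_def triangles_def cell_def)

lemma triangles_affine:
  assumes "S \<in> triangles" "u \<in> X_N L \<T>"
  obtains a c where "\<And>z. z \<in> S \<Longrightarrow> u z = a \<bullet> z + c"
proof -
  from assms(1) obtain i j where ij: "i < n - 1" "j < n - 1" and S: "S = lower i j \<or> S = upper i j"
    by (auto simp: triangles_def cells_def)
  \<comment> \<open>One uniform description of the four triangle shapes, so that the affine
    representation is transferred only once.\<close>
  have "\<exists>c p q. p \<noteq> 0 \<and> q \<noteq> 0 \<and> S = right_triangle c p q \<and> closed_triangle c p q \<in> \<T>"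
  proof -
    define dx dy where "dx = xs (Suc i) - xs i" and "dy = ys (Suc j) - ys j"
    have d: "dx \<noteq> 0" "- dx \<noteq> 0" "dy \<noteq> 0" "- dy \<noteq> 0"
      using xs_step[OF ij(1)] ys_step[OF ij(2)] by (auto simp: dx_def dy_def)
    have m: "- dx = xs i - xs (Suc i)" "- dy = ys j - ys (Suc j)" by (auto simp: dx_def dy_def)
    note mesh = closed_triangle_in_mesh[OF ij, folded m dx_def dy_def]
    from S show ?thesis
      unfolding lower_def upper_def m[symmetric] dx_def[symmetric] dy_def[symmetric]
      using mesh d by (cases "dg i j") (simp_all only: if_True if_False, blast+)
  qed
  then obtain c p q where *: "p \<noteq> 0" "q \<noteq> 0" "S = right_triangle c p q" "closed_triangle c p q \<in> \<T>"
    by blast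
  obtain a k where "\<And>z. z \<in> closed_triangle c p q \<Longrightarrow> u z = a \<bullet> z + k"
    by (rule X_N_affine[OF assms(2) *(4)]) blast
  then show ?thesis
    using that right_triangle_subset_closed[OF *(1,2), of c] *(3) by blast
qed

lemma open_triangles: "S \<in> triangles \<Longrightarrow> open S"
  by (auto simp: triangles_def lower_def upper_def open_right_triangle)

section \<open>The discrete divergence theorem\<close>

lemma has_integral_cell_flux:
  assumes u: "u \<in> X_N L \<T>" and b: "b \<in> X_N L \<T>" and "(i, j) \<in> cells"
  shows "((\<lambda>z. (Vrot (grad u) z \<bullet> grad b z) * b z) has_integral
      (edge_flux u b (xs i, ys (Suc j)) (xs (Suc i), ys (Suc j)) - edge_flux u b (xs i, ys j) (xs (Suc i), ys j))
    - (edge_flux u b (xs (Suc i), ys j) (xs (Suc i), ys (Suc j)) - edge_flux u b (xs i, ys j) (xs i, ys (Suc j))))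
    (cell (i, j))"
proof -
  have ij: "i < n - 1" "j < n - 1" using assms(3) by (auto simp: cells_def)
  let ?F = "\<lambda>z. (Vrot (grad u) z \<bullet> grad b z) * b z"
  have flux: "(?F has_integral sgn (p * q) * (edge_flux u b (c + (p, 0)) c
      + edge_flux u b c (c + (0, q)) + edge_flux u b (c + (0, q)) (c + (p, 0)))) (right_triangle c p q)"
    if mesh: "closed_triangle c p q \<in> \<T>" and "p \<noteq> 0" "q \<noteq> 0" for c p q
  proof -
    obtain a k where "\<And>z. z \<in> closed_triangle c p q \<Longrightarrow> u z = a \<bullet> z + k"
      by (rule X_N_affine[OF u mesh]) blast
    moreover obtain a' k' where "\<And>z. z \<in> closed_triangle c p q \<Longrightarrow> b z = a' \<bullet> z + k'"
      by (rule X_N_affine[OF b mesh]) blast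
    ultimately show ?thesis
      by (rule has_integral_triangle_flux[OF that(2,3)])
  qed
  have ne: "xs i - xs (Suc i) \<noteq> 0" "xs (Suc i) - xs i \<noteq> 0" "ys j - ys (Suc j) \<noteq> 0" "ys (Suc j) - ys j \<noteq> 0"
    and sgn: "sgn (xs i - xs (Suc i)) = -1" "sgn (xs (Suc i) - xs i) = 1"
      "sgn (ys j - ys (Suc j)) = -1" "sgn (ys (Suc j) - ys j) = 1"
    using xs_step[OF ij(1)] ys_step[OF ij(2)] by auto
  note mesh = closed_triangle_in_mesh[OF ij]
  let ?sw = "(xs i, ys j)" and ?se = "(xs (Suc i), ys j)"
    and ?nw = "(xs i, ys (Suc j))" and ?ne = "(xs (Suc i), ys (Suc j))"
  have neg: "negligible (lower i j \<inter> upper i j)"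
    using lower_upper_disjoint[OF ij] by simp
  \<comment> \<open>In both cases the two triangles traverse the diagonal in opposite directions, so
    its terms cancel and the clockwise flux along the four sides of the cell remains.\<close>
  show ?thesis
  proof (cases "dg i j")
    case True
    \<comment> \<open>For this diagonal the legs of each triangle have opposite signs; the resulting
      factor \<open>-1\<close> is absorbed by reversing the edges.\<close>
    have "(?F has_integral edge_flux u b ?se ?sw + edge_flux u b ?ne ?se + edge_flux u b ?sw ?ne) (lower i j)"
      using flux[OF mesh(1)[OF True] ne(1,4)]
      by (simp add: lower_def True sgn_mult sgn edge_flux_flip[of u b ?se ?sw]
          edge_flux_flip[of u b ?ne ?se] edge_flux_flip[of u b ?sw ?ne])
    moreover have "(?F has_integral edge_flux u b ?nw ?ne + edge_flux u b ?sw ?nw + edge_flux u b ?ne ?sw) (upper i j)"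
      using flux[OF mesh(3)[OF True] ne(2,3)]
      by (simp add: upper_def True sgn_mult sgn edge_flux_flip[of u b ?nw ?ne]
          edge_flux_flip[of u b ?sw ?nw] edge_flux_flip[of u b ?ne ?sw])
    ultimately have "(?F has_integral (edge_flux u b ?se ?sw + edge_flux u b ?ne ?se + edge_flux u b ?sw ?ne)
        + (edge_flux u b ?nw ?ne + edge_flux u b ?sw ?nw + edge_flux u b ?ne ?sw)) (cell (i, j))"
      unfolding cell_def prod.case using neg by (rule has_integral_Un)
    then show ?thesis
      by (simp add: edge_flux_flip[of u b ?se ?sw] edge_flux_flip[of u b ?ne ?se] edge_flux_flip[of u b ?ne ?sw]
          algebra_simps)
  next
    case False
    have "(?F has_integral edge_flux u b ?se ?sw + edge_flux u b ?sw ?nw + edge_flux u b ?nw ?se) (lower i j)"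
      using flux[OF mesh(2)[OF False] ne(2,4)]
      by (simp add: lower_def False sgn_mult sgn)
    moreover have "(?F has_integral edge_flux u b ?nw ?ne + edge_flux u b ?ne ?se + edge_flux u b ?se ?nw) (upper i j)"
      using flux[OF mesh(4)[OF False] ne(1,3)]
      by (simp add: upper_def False sgn_mult sgn)
    ultimately have "(?F has_integral (edge_flux u b ?se ?sw + edge_flux u b ?sw ?nw + edge_flux u b ?nw ?se)
        + (edge_flux u b ?nw ?ne + edge_flux u b ?ne ?se + edge_flux u b ?se ?nw)) (cell (i, j))"
      unfolding cell_def prod.case using neg by (rule has_integral_Un)
    then show ?thesis
      by (simp add: edge_flux_flip[of u b ?se ?sw] edge_flux_flip[of u b ?ne ?se] edge_flux_flip[of u b ?se ?nw]
          algebra_simps)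
  qed
qed

text \<open>The cell fluxes are differences of edge terms, so they telescope along columns and rows;
  the remaining differences between opposite sides vanish by periodicity.\<close>

lemma has_integral_flux_periodic:
  assumes u: "u \<in> X_NP L \<T>" and b: "b \<in> X_NP L \<T>"
  shows "((\<lambda>z. (Vrot (grad u) z \<bullet> grad b z) * b z) has_integral 0) (Omega L)"
proof -
  define H V where "H i j = edge_flux u b (xs i, ys j) (xs (Suc i), ys j)"
    and "V i j = edge_flux u b (xs i, ys j) (xs i, ys (Suc j))" for i j
  let ?F = "\<lambda>z. (Vrot (grad u) z \<bullet> grad b z) * b z"
  have X: "u \<in> X_N L \<T>" "b \<in> X_N L \<T>" using u b by (auto simp: X_NP_def)
  \<comment> \<open>The last node has index \<open>n - 1\<close>, so this compares the sides
    \<open>y = L\<close> and \<open>y = 0\<close>.\<close>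
  have H: "H i (n - 1) = H i 0" if "i < n - 1" for i
  proof -
    have "xs i \<in> {0..L}" "xs (Suc i) \<in> {0..L}" by (rule xs_range, use that in simp)+
    then show ?thesis using u b unfolding H_def edge_flux_def grid_ends X_NP_def by simp
  qed
  have V: "V (n - 1) j = V 0 j" if "j < n - 1" for j
  proof -
    have "ys j \<in> {0..L}" "ys (Suc j) \<in> {0..L}" by (rule ys_range, use that in simp)+
    then show ?thesis using u b unfolding V_def edge_flux_def grid_ends X_NP_def by simp
  qed
  define I where "I = (\<lambda>(i, j). (H i (Suc j) - H i j) - (V (Suc i) j - V i j))"
  have "(?F has_integral sum I cells) (\<Union>k\<in>cells. cell k)"
  proof (rule has_integral_UN)
    show "(?F has_integral I k) (cell k)" if "k \<in> cells" for k
      using has_integral_cell_flux[OF X, of "fst k" "snd k"] that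
      by (cases k) (simp add: I_def H_def V_def)
    show "pairwise (\<lambda>i i'. negligible (cell i \<inter> cell i')) cells"
      using cells_disjoint by (auto simp: pairwise_def)
  qed (rule finite_cells)
  moreover have "sum I cells = 0"
  proof -
    have "sum I cells = (\<Sum>i<n - 1. \<Sum>j<n - 1. (H i (Suc j) - H i j)) - (\<Sum>i<n - 1. \<Sum>j<n - 1. (V (Suc i) j - V i j))"
      by (simp add: I_def cells_def sum.cartesian_product[symmetric] sum_subtractf)
    also have "(\<Sum>i<n - 1. \<Sum>j<n - 1. (H i (Suc j) - H i j)) = 0"
      using H by (simp add: sum_lessThan_telescope del: One_nat_def)
    \<comment> \<open>The terms of vertical edges telescope in \<open>i\<close>, which must
      therefore become the inner index.\<close>
    also have "(\<Sum>i<n - 1. \<Sum>j<n - 1. (V (Suc i) j - V i j)) = (\<Sum>j<n - 1. \<Sum>i<n - 1. (V (Suc i) j - V i j))"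
      by (rule sum.swap)
    also have "\<dots> = 0"
      using V by (simp add: sum_lessThan_telescope[where f = "\<lambda>i. V i _"] del: One_nat_def)
    finally show ?thesis by simp
  qed
  ultimately have "(?F has_integral 0) inner_points"
    by (simp add: inner_points_def)
  then show ?thesis
  proof (rule has_integral_spike_set_eq[THEN iffD1, rotated 2])
    show "negligible {z \<in> inner_points - Omega L. ?F z \<noteq> 0}"
      by (rule negligible_subset[of "{}"]) (use inner_points_subset in auto)
    show "negligible {z \<in> Omega L - inner_points. ?F z \<noteq> 0}"
      using negligible_outside_inner_points by (rule negligible_subset) auto
  qed
qed

end

section \<open>Essentially bounded functions and linear algebra\<close>

text \<open>A class closed under sums and products that consists of integrable functions, since the
  square has finite measure. The real bound avoids arithmetic with an extended-valued essential
  supremum.\<close>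

definition ess_bounded :: "real \<Rightarrow> (real \<times> real \<Rightarrow> real) \<Rightarrow> bool" where
  "ess_bounded L f \<longleftrightarrow> f \<in> borel_measurable (lebesgue_on (Omega L)) \<and>
     (\<exists>B. AE z in lebesgue_on (Omega L). \<bar>f z\<bar> \<le> B)"

lemma ess_boundedI:
  "\<lbrakk>f \<in> borel_measurable (lebesgue_on (Omega L)); AE z in lebesgue_on (Omega L). \<bar>f z\<bar> \<le> B\<rbrakk>
   \<Longrightarrow> ess_bounded L f"
  by (auto simp: ess_bounded_def)

lemma ess_bounded_measurable: "ess_bounded L f \<Longrightarrow> f \<in> borel_measurable (lebesgue_on (Omega L))"
  by (simp add: ess_bounded_def)

lemma ess_bounded_integrable: "ess_bounded L f \<Longrightarrow> integrable (lebesgue_on (Omega L)) f"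
  using finite_measure.integrable_const_bound[OF finite_measure_lebesgue_on[OF lmeasurable_Omega], of f]
  by (auto simp: ess_bounded_def)

lemma ess_bounded_const: "ess_bounded L (\<lambda>z. c)"
  by (rule ess_boundedI[of _ _ "\<bar>c\<bar>"]) auto

lemma ess_bounded_minus: "ess_bounded L f \<Longrightarrow> ess_bounded L (\<lambda>z. - f z)"
  by (auto simp: ess_bounded_def)

lemma ess_bounded_add:
  assumes "ess_bounded L f" "ess_bounded L g"
  shows "ess_bounded L (\<lambda>z. f z + g z)"
proof -
  obtain B C where "AE z in lebesgue_on (Omega L). \<bar>f z\<bar> \<le> B" "AE z in lebesgue_on (Omega L). \<bar>g z\<bar> \<le> C"
    using assms unfolding ess_bounded_def by blast
  then have "AE z in lebesgue_on (Omega L). \<bar>f z + g z\<bar> \<le> B + C"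
    by eventually_elim linarith
  with assms show ?thesis
    by (intro ess_boundedI borel_measurable_add borel_measurable_times) (auto dest: ess_bounded_measurable)
qed

lemma ess_bounded_diff: "\<lbrakk>ess_bounded L f; ess_bounded L g\<rbrakk> \<Longrightarrow> ess_bounded L (\<lambda>z. f z - g z)"
  using ess_bounded_add[of L f "\<lambda>z. - g z"] by (simp add: ess_bounded_minus)

lemma ess_bounded_mult:
  assumes "ess_bounded L f" "ess_bounded L g"
  shows "ess_bounded L (\<lambda>z. f z * g z)"
proof -
  obtain B C where "AE z in lebesgue_on (Omega L). \<bar>f z\<bar> \<le> B" "AE z in lebesgue_on (Omega L). \<bar>g z\<bar> \<le> C"
    using assms unfolding ess_bounded_def by blast
  then have "AE z in lebesgue_on (Omega L). \<bar>f z * g z\<bar> \<le> B * C"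
    by eventually_elim (auto simp: abs_mult intro!: mult_mono)
  with assms show ?thesis
    by (intro ess_boundedI borel_measurable_add borel_measurable_times) (auto dest: ess_bounded_measurable)
qed

lemma ess_bounded_sum: "(\<And>i. i \<in> I \<Longrightarrow> ess_bounded L (f i)) \<Longrightarrow> ess_bounded L (\<lambda>z. \<Sum>i\<in>I. f i z)"
  by (induction I rule: infinite_finite_induct) (auto intro: ess_bounded_const ess_bounded_add)

lemmas ess_bounded_intros =
  ess_bounded_const ess_bounded_minus ess_bounded_add ess_bounded_diff ess_bounded_mult ess_bounded_sum

lemma Linf_ess_bounded:
  assumes "f \<in> Linf L"
  shows "ess_bounded L f"
proof -
  have "AE z in lebesgue_on (Omega L). ereal \<bar>f z\<bar> \<le> Linf_nrm L f"
    unfolding Linf_nrm_def by (rule esssup_AE)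
  then have "AE z in lebesgue_on (Omega L). \<bar>f z\<bar> \<le> real_of_ereal (Linf_nrm L f)"
    \<comment> \<open>\<open>Linf\<close> excludes the value infinity, and minus infinity cannot
      bound an absolute value, so only a finite norm is left.\<close>
    by eventually_elim (use assms in \<open>cases "Linf_nrm L f"; simp add: Linf_def\<close>)
  with assms show ?thesis
    by (intro ess_boundedI) (auto simp: Linf_def)
qed

text \<open>Moves the finite double sum under the integral. The agreement with \<open>G\<close> is
  asked for almost everywhere because gradients of linear combinations are expanded only off the
  edges.\<close>

lemma inner_matrix_integral:
  fixes a b :: "real ^ 'n"
  assumes "\<And>I J. integrable M (F I J)" and "G \<in> borel_measurable M"
    and "AE z in M. (\<Sum>I\<in>UNIV. \<Sum>J\<in>UNIV. a $ I * b $ J * F I J z) = G z"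
  shows "a \<bullet> ((\<chi> I J. LINT z|M. F I J z) *v b) = (LINT z|M. G z)"
proof -
  have "a \<bullet> ((\<chi> I J. LINT z|M. F I J z) *v b) =
      (\<Sum>I\<in>UNIV. \<Sum>J\<in>UNIV. LINT z|M. a $ I * b $ J * F I J z)"
    by (simp add: inner_vec_def matrix_vector_mult_def sum_distrib_left mult_ac)
  also have "\<dots> = (LINT z|M. (\<Sum>I\<in>UNIV. \<Sum>J\<in>UNIV. a $ I * b $ J * F I J z))"
    using assms(1) by (simp add: Bochner_Integration.integral_sum)
  also have "\<dots> = (LINT z|M. G z)"
    using assms by (intro integral_cong_AE borel_measurable_sum borel_measurable_times) auto
  finally show ?thesis .
qed

lemma block_mat_mult:
  "block_mat A B C D *v block_vec x y = block_vec (A *v x + B *v y) (C *v x + D *v y)"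
proof -
  have "(\<Sum>j\<in>UNIV. f j) = (\<Sum>j\<in>UNIV. f (Inl j)) + (\<Sum>j\<in>UNIV. f (Inr j))"
    for f :: "'c::finite + 'd::finite \<Rightarrow> real"
    by (simp add: UNIV_Plus_UNIV[symmetric] sum.Plus del: UNIV_Plus_UNIV)
  then show ?thesis
    by (auto simp: vec_eq_iff block_mat_def block_vec_def matrix_vector_mult_def split: sum.splits)
qed

lemma block_vec_eq_iff: "block_vec a b = block_vec c d \<longleftrightarrow> a = c \<and> b = d"
  by (auto simp: block_vec_def vec_eq_iff split: sum.splits)

lemma block_vec_surj: obtains a b where "x = block_vec a b"
proof
  show "x = block_vec (\<chi> k. x $ Inl k) (\<chi> k. x $ Inr k)"
    by (auto simp: block_vec_def vec_eq_iff split: sum.splits)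
qed

text \<open>For a square matrix a trivial kernel gives injectivity and, by finite dimension,
  surjectivity.\<close>

lemma block_system_unique_solution:
  fixes A B C D :: "real ^ 'n ^ 'n"
  assumes "\<And>x y. \<lbrakk>A *v x + B *v y = 0; C *v x + D *v y = 0\<rbrakk> \<Longrightarrow> x = 0 \<and> y = 0"
  shows "\<exists>!(x, y). block_mat A B C D *v block_vec x y = block_vec f g"
proof -
  let ?B = "block_mat A B C D"
  have zero: "block_vec (0 :: real ^ 'n) (0 :: real ^ 'n) = 0"
    by (auto simp: block_vec_def vec_eq_iff split: sum.splits)
  have "v = 0" if "?B *v v = 0" for v
    using that assms block_vec_surj[of v] by (metis block_mat_mult block_vec_eq_iff zero)
  then have inj: "inj ((*v) ?B)"
    by (simp add: linear_injective_0[OF matrix_vector_mul_linear])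
  then have "surj ((*v) ?B)"
    by (intro linear_inj_imp_surj matrix_vector_mul_linear)
  then obtain v where "?B *v v = block_vec f g"
    by (metis surjD)
  moreover obtain x y where "v = block_vec x y"
    using block_vec_surj by blast
  ultimately have sol: "?B *v block_vec x y = block_vec f g"
    by simp
  show ?thesis
  proof (rule ex1I[of _ "(x, y)"])
    show "case (x, y) of (x, y) \<Rightarrow> ?B *v block_vec x y = block_vec f g"
      using sol by simp
    show "w = (x, y)" if "case w of (x, y) \<Rightarrow> ?B *v block_vec x y = block_vec f g" for w
      using that sol injD[OF inj] by (cases w) (auto, (metis block_vec_eq_iff)+)
  qed
qed

section \<open>Finite element functions\<close>

context square_mesh begin

text \<open>Gradients may jump across edges, so continuity is available only off them. The edges
  form a null set and Lebesgue measure is complete, hence the values there do not affect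
  measurability.\<close>

lemma continuous_inner_points_measurable:
  fixes f :: "real \<times> real \<Rightarrow> real"
  assumes "continuous_on inner_points f"
  shows "f \<in> borel_measurable (lebesgue_on (Omega L))"
proof -
  have "f \<in> borel_measurable (lebesgue_on inner_points)"
    using assms open_inner_points by (intro continuous_imp_measurable_on_sets_lebesgue) auto
  then have "(\<lambda>z. if z \<in> inner_points then f z else 0) \<in> borel_measurable lebesgue"
    using open_inner_points by (subst borel_measurable_if) auto
  moreover have "AE z in lebesgue. z \<notin> Omega L - inner_points"
    using negligible_outside_inner_points by (intro AE_not_in) (simp add: negligible_iff_null_sets)
  then have "AE z in lebesgue. (if z \<in> inner_points then f z else 0) = (if z \<in> Omega L then f z else 0)"
    by eventually_elim (use inner_points_subset in auto)
  ultimately have "(\<lambda>z. if z \<in> Omega L then f z else 0) \<in> borel_measurable lebesgue"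
    by (rule borel_measurable_AE)
  then show ?thesis
    by (subst (asm) borel_measurable_if) (auto simp: lmeasurable_Omega fmeasurableD)
qed

lemma inner_points_subset_bar: "inner_points \<subseteq> Omega_bar L"
  using inner_points_subset by (auto simp: Omega_def Omega_bar_def)

lemma X_N_ess_bounded:
  assumes "u \<in> X_N L \<T>"
  shows "ess_bounded L u"
proof -
  have cont: "continuous_on (Omega_bar L) u" using assms by (simp add: X_N_def)
  have "compact (Omega_bar L)" unfolding Omega_bar_def by (intro compact_Times compact_Icc)
  with cont have "bounded (u ` Omega_bar L)" by (intro compact_imp_bounded compact_continuous_image)
  then obtain B where B: "\<And>z. z \<in> Omega_bar L \<Longrightarrow> \<bar>u z\<bar> \<le> B"
    by (auto simp: bounded_iff)
  show ?thesis
  proof (rule ess_boundedI)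
    show "u \<in> borel_measurable (lebesgue_on (Omega L))"
      using continuous_on_subset[OF cont inner_points_subset_bar]
      by (rule continuous_inner_points_measurable)
    show "AE z in lebesgue_on (Omega L). \<bar>u z\<bar> \<le> B"
      using AE_inner_points by eventually_elim (use B inner_points_subset_bar in auto)
  qed
qed

lemma grad_constant:
  assumes "u \<in> X_N L \<T>" "S \<in> triangles"
  obtains a where "\<And>z. z \<in> S \<Longrightarrow> grad u z = a"
proof -
  obtain a c where "\<And>z. z \<in> S \<Longrightarrow> u z = a \<bullet> z + c"
    by (rule triangles_affine[OF assms(2,1)]) blast
  then show ?thesis
    using that[of a] grad_affine[OF open_triangles[OF assms(2)], of _ u a c] by blast
qed

lemma grad_ess_bounded:
  assumes "u \<in> X_N L \<T>"
  shows "ess_bounded L (\<lambda>z. fst (grad u z))" "ess_bounded L (\<lambda>z. snd (grad u z))"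
proof -
  have "continuous_on S (grad u)" if S: "S \<in> triangles" for S
  proof -
    obtain a where "\<And>z. z \<in> S \<Longrightarrow> grad u z = a" by (rule grad_constant[OF assms S]) blast
    then show ?thesis using continuous_on_cong[of S S "grad u" "\<lambda>z. a"] by simp
  qed
  \<comment> \<open>The triangles are open, so continuity on each of them gives continuity on the
    union although the constants differ.\<close>
  then have cont: "continuous_on inner_points (grad u)"
    unfolding inner_points_eq by (intro continuous_on_open_Union open_triangles)
  have "\<exists>a. \<forall>z\<in>S. grad u z = a" if "S \<in> triangles" for S
    by (rule grad_constant[OF assms that]) blast
  then obtain a where a: "\<And>S z. S \<in> triangles \<Longrightarrow> z \<in> S \<Longrightarrow> grad u z = a S" by metis
  \<comment> \<open>The sum over the finitely many triangles is a crude common bound for the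
    constant gradients.\<close>
  have bound: "norm (grad u z) \<le> (\<Sum>S\<in>triangles. norm (a S))" if z: "z \<in> inner_points" for z
  proof -
    obtain S where "S \<in> triangles" "z \<in> S" using z by (auto simp: inner_points_eq)
    then show ?thesis using a[of S z] by (auto intro!: member_le_sum finite_triangles)
  qed
  have "\<bar>fst w\<bar> \<le> norm w" "\<bar>snd w\<bar> \<le> norm w" for w :: "real \<times> real"
    using norm_fst_le[of "fst w" "snd w"] norm_snd_le[of "snd w" "fst w"] by auto
  note le = order_trans[OF this(1) bound] order_trans[OF this(2) bound]
  show "ess_bounded L (\<lambda>z. fst (grad u z))" "ess_bounded L (\<lambda>z. snd (grad u z))"
    using AE_inner_points cont
    by (auto intro!: ess_boundedI continuous_inner_points_measurable continuous_intros
        elim!: eventually_mono dest: le)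
qed

text \<open>\<open>deriv\<close> need not be linear where summands fail to be differentiable. At an
  inner point all summands are affine on a common open triangle, and so is their
  combination.\<close>

lemma grad_sum:
  assumes "\<And>l. \<phi> l \<in> X_N L \<T>" "z \<in> inner_points"
  shows "grad (\<lambda>w. \<Sum>l\<in>A. c l * \<phi> l w) z = (\<Sum>l\<in>A. c l *\<^sub>R grad (\<phi> l) z)"
proof -
  obtain S where S: "S \<in> triangles" "z \<in> S" using assms(2) by (auto simp: inner_points_eq)
  have "\<exists>a k. \<forall>w\<in>S. \<phi> l w = a \<bullet> w + k" for l
    by (rule triangles_affine[OF S(1) assms(1)[of l]]) blast
  then obtain a k where ak: "\<And>l w. w \<in> S \<Longrightarrow> \<phi> l w = a l \<bullet> w + k l" by metis
  have "grad (\<phi> l) z = a l" for l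
    using grad_affine[OF open_triangles[OF S(1)] S(2) ak] .
  moreover have "grad (\<lambda>w. \<Sum>l\<in>A. c l * \<phi> l w) z = (\<Sum>l\<in>A. c l *\<^sub>R a l)"
    by (rule grad_affine[OF open_triangles[OF S(1)] S(2), where k = "\<Sum>l\<in>A. c l * k l"])
       (simp add: ak inner_sum_left sum.distrib[symmetric] algebra_simps)
  ultimately show ?thesis by simp
qed

lemma X_NP_sum:
  assumes "\<And>l. \<phi> l \<in> X_NP L \<T>"
  shows "(\<lambda>z. \<Sum>l\<in>A. c l * \<phi> l z) \<in> X_NP L \<T>"
proof -
  have X: "\<phi> l \<in> X_N L \<T>" for l using assms by (simp add: X_NP_def)
  have "\<exists>a k. \<forall>z\<in>K. (\<Sum>l\<in>A. c l * \<phi> l z) = a \<bullet> z + k" if "K \<in> \<T>" for K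
  proof -
    have "\<exists>a k. \<forall>w\<in>K. \<phi> l w = a \<bullet> w + k" for l
      using X[of l] that by (simp add: X_N_def)
    then obtain a k where "\<And>l w. w \<in> K \<Longrightarrow> \<phi> l w = a l \<bullet> w + k l" by metis
    then show ?thesis
      by (intro exI[of _ "\<Sum>l\<in>A. c l *\<^sub>R a l"] exI[of _ "\<Sum>l\<in>A. c l * k l"])
         (simp add: inner_sum_left sum.distrib[symmetric] algebra_simps)
  qed
  moreover have "continuous_on (Omega_bar L) (\<lambda>z. \<Sum>l\<in>A. c l * \<phi> l z)"
    using X by (intro continuous_intros) (simp add: X_N_def)
  ultimately have "(\<lambda>z. \<Sum>l\<in>A. c l * \<phi> l z) \<in> X_N L \<T>"
    by (simp add: X_N_def)
  with assms show ?thesis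
    by (simp add: X_NP_def)
qed

text \<open>Inside the square the set where \<open>u\<close> does not vanish is open and null, hence
  empty; continuity carries the value 0 to the boundary, where some of the nodes lie.\<close>

lemma X_N_zero:
  assumes "u \<in> X_N L \<T>" "L2_inner L u u = 0" "z \<in> Omega_bar L"
  shows "u z = 0"
proof -
  have cont: "continuous_on (Omega_bar L) u" using assms by (simp add: X_N_def)
  have openO: "open (Omega L)" unfolding Omega_def by (intro open_Times) auto
  have cl: "closure (Omega L) = Omega_bar L"
    unfolding Omega_def Omega_bar_def using L by (simp add: closure_Times)
  have "AE z in lebesgue_on (Omega L). u z * u z = 0"
    using assms(2) X_N_ess_bounded[OF assms(1)] unfolding L2_inner_def
    by (subst (asm) integral_nonneg_eq_0_iff_AE) (auto intro!: ess_bounded_integrable ess_bounded_mult)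
  then have "AE z in lebesgue. z \<in> Omega L \<longrightarrow> u z * u z = 0"
    by (subst (asm) AE_restrict_space_iff) (simp_all add: lmeasurable_Omega fmeasurableD)
  define N where "N = {z \<in> Omega L. u z \<noteq> 0}"
  have "open N"
  proof -
    have "open (Omega L \<inter> u -` (- {0}))"
      using continuous_on_subset[OF cont, of "Omega L"] cl closure_subset openO
      by (intro continuous_open_preimage) auto
    moreover have "N = Omega L \<inter> u -` (- {0})" by (auto simp: N_def)
    ultimately show ?thesis by simp
  qed
  moreover have "AE z in lebesgue. z \<notin> N"
    using \<open>AE z in lebesgue. z \<in> Omega L \<longrightarrow> u z * u z = 0\<close>
    by eventually_elim (simp add: N_def)
  then have "negligible N"
    using \<open>open N\<close> by (subst negligible_iff_null_sets, subst AE_iff_null_sets) auto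
  ultimately have "N = {}"
    using open_not_negligible by blast
  then have "u w = 0" if "w \<in> Omega L" for w using that unfolding N_def by blast
  moreover have "continuous_on (closure (Omega L)) u" "z \<in> closure (Omega L)"
    using cont assms(3) by (simp_all add: cl)
  ultimately show ?thesis
    by (intro continuous_constant_on_closure[of "Omega L" u 0 z])
qed

end

abbreviation comb :: "('N::finite \<Rightarrow> real \<times> real \<Rightarrow> real) \<Rightarrow> real ^ 'N \<Rightarrow> real \<times> real \<Rightarrow> real" where
  "comb \<phi> a \<equiv> \<lambda>z. \<Sum>l\<in>UNIV. a $ l * \<phi> l z"

lemma inner_sum_sum:
  fixes x y :: "'i \<Rightarrow> 'a::real_inner"
  shows "(\<Sum>i\<in>A. a i *\<^sub>R x i) \<bullet> (\<Sum>j\<in>B. b j *\<^sub>R y j) = (\<Sum>i\<in>A. \<Sum>j\<in>B. a i * b j * (x i \<bullet> y j))"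
  by (simp only: inner_sum_left) (simp add: inner_sum_right sum_distrib_left mult_ac)

lemma matrix_vector_mult_minus_left: "(- A) *v x = - (A *v x)"
  for A :: "real ^ 'n ^ 'm"
  by (simp add: vec_eq_iff matrix_vector_mult_def sum_negf)

section \<open>Quadratic forms of the matrices as integrals of finite element functions\<close>

context square_mesh begin

lemma X_NP_X_N: "u \<in> X_NP L \<T> \<Longrightarrow> u \<in> X_N L \<T>"
  by (simp add: X_NP_def)

lemma ess_bounded_grad_inner:
  assumes "u \<in> X_N L \<T>" "ess_bounded L (\<lambda>z. fst (g z))" "ess_bounded L (\<lambda>z. snd (g z))"
  shows "ess_bounded L (\<lambda>z. g z \<bullet> grad u z)" "ess_bounded L (\<lambda>z. Vrot g z \<bullet> grad u z)"
  using assms grad_ess_bounded[OF assms(1)]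
  by (auto simp: inner_prod_def Vrot_def intro!: ess_bounded_intros)

context
  fixes \<phi> :: "'N::finite \<Rightarrow> real \<times> real \<Rightarrow> real"
  assumes \<phi>: "\<And>l. \<phi> l \<in> X_NP L \<T>"
begin

lemma comb_X_NP: "comb \<phi> a \<in> X_NP L \<T>"
  by (intro X_NP_sum \<phi>)

lemmas comb_bounded = X_N_ess_bounded[OF X_NP_X_N[OF comb_X_NP]]
lemmas comb_grad_bounded = grad_ess_bounded[OF X_NP_X_N[OF comb_X_NP]]
lemmas basis_bounded = X_N_ess_bounded[OF X_NP_X_N[OF \<phi>]]

lemma grad_comb: "z \<in> inner_points \<Longrightarrow> grad (comb \<phi> a) z = (\<Sum>l\<in>UNIV. a $ l *\<^sub>R grad (\<phi> l) z)"
  by (intro grad_sum X_NP_X_N \<phi>)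

lemma inner_M_mat: "a \<bullet> (M_mat L \<phi> *v b) = L2_inner L (comb \<phi> a) (comb \<phi> b)"
  unfolding M_mat_def L2_inner_def
proof (rule inner_matrix_integral)
  show "AE z in lebesgue_on (Omega L). (\<Sum>I\<in>UNIV. \<Sum>J\<in>UNIV. a $ I * b $ J * (\<phi> I z * \<phi> J z)) = comb \<phi> a z * comb \<phi> b z"
    by (simp add: sum_product mult_ac)
qed (intro ess_bounded_integrable ess_bounded_measurable ess_bounded_mult basis_bounded comb_bounded)+

lemma inner_K_mat: "a \<bullet> (K_mat L \<phi> *v b) = H1_inner L (comb \<phi> a) (comb \<phi> b)"
proof -
  \<comment> \<open>The two integrals in \<open>H1_inner\<close> are merged because
    \<open>inner_matrix_integral\<close> handles a single integrand.\<close>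
  have H1: "H1_inner L u v = (LINT z|lebesgue_on (Omega L). u z * v z + grad u z \<bullet> grad v z)"
    if "u \<in> X_N L \<T>" "v \<in> X_N L \<T>" for u v
    unfolding H1_inner_def L2_inner_def
    by (intro Bochner_Integration.integral_add[symmetric] ess_bounded_integrable ess_bounded_mult
        X_N_ess_bounded ess_bounded_grad_inner grad_ess_bounded that)
  show ?thesis
    unfolding K_mat_def H1[OF X_NP_X_N[OF \<phi>] X_NP_X_N[OF \<phi>]] H1[OF X_NP_X_N[OF comb_X_NP] X_NP_X_N[OF comb_X_NP]]
  proof (rule inner_matrix_integral)
    show "AE z in lebesgue_on (Omega L). (\<Sum>I\<in>UNIV. \<Sum>J\<in>UNIV. a $ I * b $ J * (\<phi> I z * \<phi> J z + grad (\<phi> I) z \<bullet> grad (\<phi> J) z))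
        = comb \<phi> a z * comb \<phi> b z + grad (comb \<phi> a) z \<bullet> grad (comb \<phi> b) z"
      using AE_inner_points
      by eventually_elim
        (simp add: grad_comb inner_sum_sum sum_product distrib_left sum.distrib mult_ac)
  qed (intro ess_bounded_integrable ess_bounded_measurable ess_bounded_mult ess_bounded_add
      ess_bounded_grad_inner X_NP_X_N \<phi> comb_X_NP grad_ess_bounded basis_bounded comb_bounded)+
qed

lemma inner_R_mat:
  assumes "ess_bounded L (\<lambda>z. fst (g z))" "ess_bounded L (\<lambda>z. snd (g z))"
  shows "a \<bullet> (R_mat L g \<phi> *v b) = L2_inner L (\<lambda>z. Vrot g z \<bullet> grad (comb \<phi> b) z) (comb \<phi> a)"
  unfolding R_mat_def L2_inner_def
proof (rule inner_matrix_integral)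
  show "AE z in lebesgue_on (Omega L).
      (\<Sum>I\<in>UNIV. \<Sum>J\<in>UNIV. a $ I * b $ J * ((Vrot g z \<bullet> grad (\<phi> J) z) * \<phi> I z))
      = (Vrot g z \<bullet> grad (comb \<phi> b) z) * comb \<phi> a z"
    using AE_inner_points
    by eventually_elim
      (simp add: grad_comb sum_product inner_sum_right mult_ac)
qed (intro ess_bounded_integrable ess_bounded_measurable ess_bounded_mult
      ess_bounded_grad_inner X_NP_X_N \<phi> comb_X_NP assms basis_bounded comb_bounded)+

text \<open>With the same vector on both sides, the form is minus the integral of the flux of
  \<open>comb \<phi> U\<close> and \<open>comb \<phi> b\<close>, which vanishes by the discrete
  divergence theorem.\<close>

lemma inner_S_mat_self: "b \<bullet> (S_mat L \<phi> U *v b) = 0"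
proof -
  let ?g = "grad (comb \<phi> U)"
  have "b \<bullet> (S_mat L \<phi> U *v b) =
      (LINT z|lebesgue_on (Omega L). - ((Vrot ?g z \<bullet> grad (comb \<phi> b) z) * comb \<phi> b z))"
    unfolding S_mat_def L2_inner_def Bochner_Integration.integral_minus[symmetric]
  proof (rule inner_matrix_integral)
    show "AE z in lebesgue_on (Omega L).
        (\<Sum>I\<in>UNIV. \<Sum>J\<in>UNIV. b $ I * b $ J * - ((Vrot ?g z \<bullet> grad (\<phi> I) z) * \<phi> J z))
        = - ((Vrot ?g z \<bullet> grad (comb \<phi> b) z) * comb \<phi> b z)"
      using AE_inner_points
      by eventually_elim
        (subst sum.swap, simp add: grad_comb[of _ b] sum_product inner_sum_right sum_negf mult_ac)
  qed (intro ess_bounded_integrable ess_bounded_measurable ess_bounded_mult ess_bounded_minus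
      ess_bounded_grad_inner X_NP_X_N \<phi> comb_X_NP comb_grad_bounded basis_bounded comb_bounded)+
  also have "\<dots> = - (LINT z|lebesgue_on (Omega L). (Vrot ?g z \<bullet> grad (comb \<phi> b) z) * comb \<phi> b z)"
    by (rule Bochner_Integration.integral_minus)
  also have "(LINT z|lebesgue_on (Omega L). (Vrot ?g z \<bullet> grad (comb \<phi> b) z) * comb \<phi> b z) = 0"
  \<comment> \<open>The Lebesgue integral is also the gauge integral, in which the flux was
    computed, and the latter is unique.\<close>
  proof (rule has_integral_unique)
    show "((\<lambda>z. (Vrot ?g z \<bullet> grad (comb \<phi> b) z) * comb \<phi> b z) has_integral
        (LINT z|lebesgue_on (Omega L). (Vrot ?g z \<bullet> grad (comb \<phi> b) z) * comb \<phi> b z)) (Omega L)"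
      by (intro has_integral_integral_lebesgue_on ess_bounded_integrable ess_bounded_mult
          ess_bounded_grad_inner X_NP_X_N comb_X_NP comb_grad_bounded comb_bounded
          fmeasurableD lmeasurable_Omega)
    show "((\<lambda>z. (Vrot ?g z \<bullet> grad (comb \<phi> b) z) * comb \<phi> b z) has_integral 0) (Omega L)"
      by (intro has_integral_flux_periodic comb_X_NP)
  qed
  finally show ?thesis by simp
qed

end

end

section \<open>The energy estimate\<close>

lemma W1inf_gradient_bound:
  assumes "W1inf L p g" "0 < \<tau>" "ereal \<tau> \<le> 1 / (4 * W1inf_nrm L p g)"
  shows "AE z in lebesgue_on (Omega L). \<tau> * \<bar>fst (g z)\<bar> \<le> 1 / 4 \<and> \<tau> * \<bar>snd (g z)\<bar> \<le> 1 / 4"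
proof -
  \<comment> \<open>An infinite norm would make the upper bound for \<tau> equal to 0, against
    \<open>0 < \<tau>\<close>.\<close>
  obtain P where P: "W1inf_nrm L p g = ereal P"
    using assms(2,3) by (cases "W1inf_nrm L p g") auto
  have "\<tau> * P \<le> 1 / 4"
  \<comment> \<open>The reciprocal can be cleared for positive \<open>P\<close>; otherwise
    \<open>\<tau> * P\<close> is nonpositive, which covers the convention that 1/0 is
    infinite.\<close>
  proof (cases "P > 0")
    case True
    then have "\<tau> \<le> 1 / (4 * P)" using assms(3) unfolding P by (simp add: one_ereal_def)
    with True show ?thesis by (simp add: field_simps)
  next
    case False
    then have "\<tau> * P \<le> 0" using assms(2) by (simp add: mult_nonneg_nonpos)
    then show ?thesis by simp
  qed
  have bound: "\<tau> * x \<le> 1 / 4" if "x \<le> P" for x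
    using that assms(2) by (intro order_trans[OF mult_left_mono \<open>\<tau> * P \<le> 1 / 4\<close>]) auto
  have nrm: "Linf_nrm L (\<lambda>z. fst (g z)) \<le> ereal P" "Linf_nrm L (\<lambda>z. snd (g z)) \<le> ereal P"
    unfolding P[symmetric] W1inf_nrm_def by (auto simp: le_max_iff_disj)
  have "AE z in lebesgue_on (Omega L). ereal \<bar>fst (g z)\<bar> \<le> Linf_nrm L (\<lambda>z. fst (g z))"
    "AE z in lebesgue_on (Omega L). ereal \<bar>snd (g z)\<bar> \<le> Linf_nrm L (\<lambda>z. snd (g z))"
    unfolding Linf_nrm_def by (rule esssup_AE)+
  then show ?thesis
    by eventually_elim (metis bound order_trans nrm ereal_less_eq(3))
qed

text \<open>Here \<open>e\<close> stands for the weak gradient of the given function and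
  \<open>d\<close> for the gradient of the unknown one. Each component \<open>s\<close> of
  \<open>d\<close> contributes at most \<open>\<bar>s\<bar> * \<bar>v\<bar> / 4\<close>, hence at
  most an eighth of the sum of both squares; adding two such terms doubles only the share of
  \<open>v\<close>.\<close>

lemma young_bound:
  fixes \<tau> v :: real and d e :: "real \<times> real"
  assumes "\<tau> * \<bar>fst e\<bar> \<le> 1 / 4" "\<tau> * \<bar>snd e\<bar> \<le> 1 / 4" "0 < \<tau>"
  shows "\<tau> * (((- snd e, fst e) \<bullet> d) * v) \<le> (d \<bullet> d) / 8 + v * v / 4"
proof -
  have *: "\<tau> * (r * s * v) \<le> s * s / 8 + v * v / 8" if "\<tau> * \<bar>r\<bar> \<le> 1 / 4" for r s :: real
  proof -
    have "\<tau> * (r * s * v) \<le> (\<tau> * \<bar>r\<bar>) * (\<bar>s\<bar> * \<bar>v\<bar>)"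
      using abs_ge_self[of "\<tau> * (r * s * v)"] assms(3) by (simp add: abs_mult mult_ac)
    also have "\<dots> \<le> 1 / 4 * (\<bar>s\<bar> * \<bar>v\<bar>)"
      using that by (intro mult_right_mono) auto
    also have "\<dots> \<le> s * s / 8 + v * v / 8"
      using sum_squares_bound[of "\<bar>s\<bar>" "\<bar>v\<bar>"] by (simp add: power2_eq_square)
    finally show ?thesis .
  qed
  show ?thesis
    using *[of "- snd e" "fst d"] *[of "fst e" "snd d"] assms
    by (simp add: inner_prod_def algebra_simps add_divide_distrib)
qed

context square_mesh begin

text \<open>Let \<open>A\<close> and \<open>B\<close> be the squared L2 norms of \<open>v\<close>
  and \<open>w\<close>, and \<open>D\<close> that of the gradient of \<open>w\<close>. Young's
  inequality in \<open>eq1\<close> gives \<open>A \<le> D / 8 + A / 4\<close>, so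
  \<open>A \<le> D / 6\<close>; in \<open>eq2\<close> it gives \<open>B / 2 + D \<le> A / 2\<close>.
  Together \<open>A \<le> A / 12\<close>, so \<open>A\<close> vanishes and then \<open>B\<close>
  does.\<close>

lemma weak_system_trivial:
  assumes v: "v \<in> X_N L \<T>" and w: "w \<in> X_N L \<T>"
    and g: "ess_bounded L (\<lambda>z. fst (g z))" "ess_bounded L (\<lambda>z. snd (g z))"
    and \<tau>: "0 < \<tau>"
    and bound: "AE z in lebesgue_on (Omega L). \<tau> * \<bar>fst (g z)\<bar> \<le> 1 / 4 \<and> \<tau> * \<bar>snd (g z)\<bar> \<le> 1 / 4"
    and eq1: "L2_inner L v v = \<tau> * L2_inner L (\<lambda>z. Vrot g z \<bullet> grad w z) v"
    and eq2: "H1_inner L w w = L2_inner L w v"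
  shows "L2_inner L v v = 0 \<and> L2_inner L w w = 0"
proof -
  define D where "D = (LINT z|lebesgue_on (Omega L). grad w z \<bullet> grad w z)"
  note int = ess_bounded_integrable ess_bounded_intros X_N_ess_bounded ess_bounded_grad_inner
    grad_ess_bounded v w g
  have nn: "0 \<le> L2_inner L u u" for u
    unfolding L2_inner_def by (rule Bochner_Integration.integral_nonneg) simp
  have "L2_inner L v v = (LINT z|lebesgue_on (Omega L). \<tau> * ((Vrot g z \<bullet> grad w z) * v z))"
    by (simp add: eq1) (simp add: L2_inner_def)
  also have "\<dots> \<le> (LINT z|lebesgue_on (Omega L). 1 / 8 * (grad w z \<bullet> grad w z) + 1 / 4 * (v z * v z))"
  proof (rule integral_mono_AE)
    show "AE z in lebesgue_on (Omega L). \<tau> * ((Vrot g z \<bullet> grad w z) * v z)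
        \<le> 1 / 8 * (grad w z \<bullet> grad w z) + 1 / 4 * (v z * v z)"
      using bound by eventually_elim (use young_bound[OF _ _ \<tau>] in \<open>simp add: Vrot_def\<close>)
  qed (intro int)+
  also have "\<dots> = (LINT z|lebesgue_on (Omega L). 1 / 8 * (grad w z \<bullet> grad w z))
      + (LINT z|lebesgue_on (Omega L). 1 / 4 * (v z * v z))"
    by (intro Bochner_Integration.integral_add int)
  finally have 1: "L2_inner L v v \<le> D / 8 + L2_inner L v v / 4"
    by (simp add: D_def L2_inner_def)
  have "L2_inner L w v \<le> (LINT z|lebesgue_on (Omega L). 1 / 2 * (w z * w z) + 1 / 2 * (v z * v z))"
    unfolding L2_inner_def
  proof (rule integral_mono)
    show "w z * v z \<le> 1 / 2 * (w z * w z) + 1 / 2 * (v z * v z)" for z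
      using sum_squares_bound[of "w z" "v z"] by (simp add: power2_eq_square)
  qed (intro int)+
  also have "\<dots> = (LINT z|lebesgue_on (Omega L). 1 / 2 * (w z * w z))
      + (LINT z|lebesgue_on (Omega L). 1 / 2 * (v z * v z))"
    by (intro Bochner_Integration.integral_add int)
  finally have "L2_inner L w v \<le> L2_inner L w w / 2 + L2_inner L v v / 2"
    by (simp add: L2_inner_def)
  then have 2: "L2_inner L w w / 2 + D \<le> L2_inner L v v / 2"
    using eq2 by (simp add: H1_inner_def D_def)
  have "0 \<le> D"
    unfolding D_def by (rule Bochner_Integration.integral_nonneg) simp
  with 1 2 nn[of v] nn[of w] show ?thesis by linarith
qed

end

section \<open>Unique solvability of the block system\<close>

theorem theorem4p4:
  fixes L h c0inv \<tau> t :: real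
    and n :: nat
    and xs ys :: "nat \<Rightarrow> real"
    and dg :: "nat \<Rightarrow> nat \<Rightarrow> bool"
    and p :: "real \<times> real \<Rightarrow> real"
    and gp :: "real \<times> real \<Rightarrow> real \<times> real"
    and \<phi> :: "'N::finite \<Rightarrow> real \<times> real \<Rightarrow> real"
    and W :: "real \<Rightarrow> real ^ 'N"
  assumes "L > 0" and "n \<ge> 2"
    and "W1inf L p gp"
    and "tensor_grid L n xs ys"
    and "h = mesh_size (mesh_triangles n xs ys dg)"
    and "CARD('N) = (n - 1)\<^sup>2"
    and "nodal_basis L n xs ys dg \<phi>"
    and "c0inv > 0"
    and "\<forall>v \<in> X_N L (mesh_triangles n xs ys dg). H1_nrm L v \<le> c0inv / h * L2_nrm L v"
    and "0 < \<tau>"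
    and "ereal \<tau> \<le> min (1 / (4 * W1inf_nrm L p gp))
                        (ereal (h\<^sup>2) / ereal (16 * c0inv * mat_nrm (M_mat L \<phi>) (W t)))"
  shows "\<forall>(U :: real ^ 'N) (\<gamma> :: real ^ 'N). \<exists>!(\<alpha>, \<beta>).
           block_mat (- (\<tau> *\<^sub>R R_mat L gp \<phi>)) (M_mat L \<phi> + \<tau> *\<^sub>R S_mat L \<phi> U)
                     (K_mat L \<phi>) (- M_mat L \<phi>) *v block_vec \<alpha> \<beta>
           = block_vec (M_mat L \<phi> *v \<gamma>) 0"
proof (intro allI block_system_unique_solution)
  interpret square_mesh L n xs ys dg
    by unfold_locales fact+
  fix U \<gamma> \<alpha> \<beta> :: "real ^ 'N"
  assume eq1: "(- (\<tau> *\<^sub>R R_mat L gp \<phi>)) *v \<alpha> + (M_mat L \<phi> + \<tau> *\<^sub>R S_mat L \<phi> U) *v \<beta> = 0"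
    and eq2: "K_mat L \<phi> *v \<alpha> + (- M_mat L \<phi>) *v \<beta> = 0"
  obtain node where node: "bij_betw node (UNIV :: 'N set) (xs ` {..<n - 1} \<times> ys ` {..<n - 1})"
    and \<phi>: "\<And>I. \<phi> I \<in> X_NP L \<T>"
    and nodal: "\<And>I J. \<phi> I (node J) = (if I = J then 1 else 0)"
    using \<open>nodal_basis L n xs ys dg \<phi>\<close> unfolding nodal_basis_def by blast
  have g: "ess_bounded L (\<lambda>z. fst (gp z))" "ess_bounded L (\<lambda>z. snd (gp z))"
    using \<open>W1inf L p gp\<close> by (auto simp: W1inf_def intro: Linf_ess_bounded)
  let ?v = "comb \<phi> \<beta>" and ?w = "comb \<phi> \<alpha>"
  have S: "\<beta> \<bullet> (S_mat L \<phi> U *v \<beta>) = 0"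
    by (rule inner_S_mat_self[OF \<phi>])
  \<comment> \<open>Testing the first block row with \<beta> removes the \<open>S_mat\<close> term
    by \<open>S\<close> and leaves a balance of the mass and \<open>R_mat\<close> terms.\<close>
  have "\<beta> \<bullet> ((- (\<tau> *\<^sub>R R_mat L gp \<phi>)) *v \<alpha> + (M_mat L \<phi> + \<tau> *\<^sub>R S_mat L \<phi> U) *v \<beta>) = 0"
    by (simp add: eq1)
  then have "\<beta> \<bullet> (M_mat L \<phi> *v \<beta>) = \<tau> * (\<beta> \<bullet> (R_mat L gp \<phi> *v \<alpha>))"
    using S by (simp add: inner_add_right inner_diff_right matrix_vector_mult_add_rdistrib
        scaleR_matrix_vector_assoc[symmetric] matrix_vector_mult_minus_left)
  then have "L2_inner L ?v ?v = \<tau> * L2_inner L (\<lambda>z. Vrot gp z \<bullet> grad ?w z) ?v"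
    by (simp only: inner_M_mat[where \<phi> = \<phi>, OF \<phi>] inner_R_mat[where \<phi> = \<phi>, OF \<phi> g])
  \<comment> \<open>Testing the second block row with \<alpha> turns it into an identity for the H1
    energy of \<open>?w\<close>.\<close>
  moreover have "K_mat L \<phi> *v \<alpha> = M_mat L \<phi> *v \<beta>"
    using eq2 by (simp add: matrix_vector_mult_minus_left)
  then have "\<alpha> \<bullet> (K_mat L \<phi> *v \<alpha>) = \<alpha> \<bullet> (M_mat L \<phi> *v \<beta>)"
    by simp
  then have "H1_inner L ?w ?w = L2_inner L ?w ?v"
    by (simp only: inner_K_mat[where \<phi> = \<phi>, OF \<phi>] inner_M_mat[where \<phi> = \<phi>, OF \<phi>])
  ultimately have zero: "L2_inner L ?v ?v = 0 \<and> L2_inner L ?w ?w = 0"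
    using assms(11)
    by (intro weak_system_trivial[OF _ _ g \<open>0 < \<tau>\<close>] W1inf_gradient_bound[OF \<open>W1inf L p gp\<close> \<open>0 < \<tau>\<close>]
        X_NP_X_N comb_X_NP \<phi>) simp_all
  \<comment> \<open>A function of norm zero vanishes at every node, and its nodal values are its
    coefficients.\<close>
  have coeff: "a = 0" if "L2_inner L (comb \<phi> a) (comb \<phi> a) = 0" for a
  proof -
    have "a $ J = 0" for J
    proof -
      have "node J \<in> xs ` {..<n - 1} \<times> ys ` {..<n - 1}"
        using node by (auto simp: bij_betw_def)
      then have "node J \<in> Omega_bar L"
        using xs_range ys_range by (force simp: Omega_bar_def)
      then have "comb \<phi> a (node J) = 0"
        using X_N_zero[OF X_NP_X_N[OF comb_X_NP[OF \<phi>]] that] by blast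
      then show ?thesis by (simp add: nodal if_distrib[of "(*) _"] cong: if_cong)
    qed
    then show ?thesis by (simp add: vec_eq_iff)
  qed
  show "\<alpha> = 0 \<and> \<beta> = 0"
    using zero coeff by blast
qed

end
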